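(* Let $T$ be a rooted tree, $v \in V(T)$, and $p = p(v)$ (with $p=\emptyset$ if $v$ is the root). The procedure $\textsc{Claw-Deletion-Set}(T,v,p)$ described below returns a minimum claw-deletion set $S$ of $T_v^+$ such that: if $\mathrm{cdn}(T_v^+) = 1 + \mathrm{cdn}(T_v)$ then $p \in S$; and if $\mathrm{cdn}(T_v^+) = \mathrm{cdn}(T_v)$ and $\mathrm{cdn}(T_v) = 1 + \mathrm{cdn}(T_v \setminus \{v\})$ then $v \in S$. Consequently, given a forest $F$ and a positive integer $k$, the problem of deciding whether $F$ can be transformed into a linear forest by deleting at most $k$ vertices can be solved in linear time.
   Context: All graphs are finite, simple and undirected. A claw is $K_{1,3}$; a graph is claw-free if it has no induced $K_{1,3}$. A set $S\subseteq V(G)$ is a claw-deletion set of $G$ if $G\setminus S$ (the subgraph induced by $V(G)\setminus S$) is claw-free, and $\mathrm{cdn}(G)$ denotes the minimum cardinality of a claw-deletion set of $G$. A linear forest is a disjoint union of induced paths (equivalently, a claw-free forest). For a rooted tree $T$ and $v\in V(T)$: $T_v$ is the subtree rooted at $v$, $C(v)$ is the set of children of $v$, $p(v)$ is the parent of $v$ (for the root $r$, $p(r)=\emptyset$), $T_v^+$ is the subgraph of $T$ induced by $V(T_v)\cup\{p(v)\}$, and $T_r^+ = T$. Procedure $\textsc{Claw-Deletion-Set}(T,v,p)$: if $C(v)=\emptyset$, return $\emptyset$. Otherwise, set $S:=\emptyset$; for each $u \in C(v)$, set $S := S \cup \textsc{Claw-Deletion-Set}(T,u,v)$; let $c := |C(v)\setminus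 S|$; if $c \geq 3$, set $S := S\cup\{v\}$; else if $c = 2$ and $p \neq \emptyset$ and $v \notin S$, set $S := S \cup \{p\}$; return $S$. *)

theory Defs
  imports Main "HOL-Library.Disjoint_Sets"
begin

record 'a graph =
  verts :: "'a set"
  edges :: "'a set set"

definition simple_graph :: "'a graph \<Rightarrow> bool" where
  "simple_graph G \<longleftrightarrow> finite (verts G) \<and> (\<forall>e\<in>edges G. e \<subseteq> verts G \<and> card e = 2)"

definition induced :: "'a graph \<Rightarrow> 'a set \<Rightarrow> 'a graph" where
  "induced G X = \<lparr>verts = verts G \<inter> X, edges = {e \<in> edges G. e \<subseteq> X}\<rparr>"

definition delete_verts :: "'a graph \<Rightarrow> 'a set \<Rightarrow> 'a graph" where
  "delete_verts G S = induced G (verts G - S)"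

definition graph_iso :: "'a graph \<Rightarrow> 'b graph \<Rightarrow> bool" where
  "graph_iso G H \<longleftrightarrow> (\<exists>f. bij_betw f (verts G) (verts H) \<and> edges H = (\<lambda>e. f ` e) ` edges G)"


section \<open>Claw deletion\<close>

definition claw :: "nat graph" where
  "claw = \<lparr>verts = {0, 1, 2, 3}, edges = {{0, 1}, {0, 2}, {0, 3}}\<rparr>"

definition claw_free :: "'a graph \<Rightarrow> bool" where
  "claw_free G \<longleftrightarrow> \<not> (\<exists>X\<subseteq>verts G. graph_iso (induced G X) claw)"

definition claw_deletion_set :: "'a graph \<Rightarrow> 'a set \<Rightarrow> bool" where
  "claw_deletion_set G S \<longleftrightarrow> S \<subseteq> verts G \<and> claw_free (delete_verts G S)"

definition cdn :: "'a graph \<Rightarrow> nat" where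
  "cdn G = (LEAST k. \<exists>S. claw_deletion_set G S \<and> card S = k)"

definition min_claw_deletion_set :: "'a graph \<Rightarrow> 'a set \<Rightarrow> bool" where
  "min_claw_deletion_set G S \<longleftrightarrow> claw_deletion_set G S \<and> card S = cdn G"


section \<open>Forests and rooted trees\<close>

definition path :: "'a graph \<Rightarrow> 'a list \<Rightarrow> bool" where
  "path G xs \<longleftrightarrow> xs \<noteq> [] \<and> distinct xs \<and> set xs \<subseteq> verts G \<and>
     successively (\<lambda>x y. {x, y} \<in> edges G) xs"

definition path_between :: "'a graph \<Rightarrow> 'a \<Rightarrow> 'a \<Rightarrow> 'a list \<Rightarrow> bool" where
  "path_between G u v xs \<longleftrightarrow> path G xs \<and> hd xs = u \<and> last xs = v"

definition cycle :: "'a graph \<Rightarrow> 'a list \<Rightarrow> bool" where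
  "cycle G xs \<longleftrightarrow> path G xs \<and> 3 \<le> length xs \<and> {last xs, hd xs} \<in> edges G"

definition connected :: "'a graph \<Rightarrow> bool" where
  "connected G \<longleftrightarrow> verts G \<noteq> {} \<and> (\<forall>u\<in>verts G. \<forall>v\<in>verts G. \<exists>xs. path_between G u v xs)"

definition forest :: "'a graph \<Rightarrow> bool" where
  "forest G \<longleftrightarrow> simple_graph G \<and> (\<nexists>xs. cycle G xs)"

definition tree :: "'a graph \<Rightarrow> bool" where
  "tree G \<longleftrightarrow> forest G \<and> connected G"

definition path_graph :: "'a graph \<Rightarrow> bool" where
  "path_graph G \<longleftrightarrow> (\<exists>xs. xs \<noteq> [] \<and> distinct xs \<and> verts G = set xs \<and>
     edges G = {{xs ! i, xs ! Suc i} | i. Suc i < length xs})"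

definition linear_forest :: "'a graph \<Rightarrow> bool" where
  "linear_forest G \<longleftrightarrow> (\<exists>\<P>. partition_on (verts G) \<P> \<and>
     (\<forall>P\<in>\<P>. path_graph (induced G P)) \<and> (\<forall>e\<in>edges G. \<exists>P\<in>\<P>. e \<subseteq> P))"

definition rooted_tree :: "'a graph \<Rightarrow> 'a \<Rightarrow> bool" where
  "rooted_tree T r \<longleftrightarrow> tree T \<and> r \<in> verts T"

text \<open>In a tree there is exactly one path from the root to a given vertex; \<^term>\<open>a\<close> is a
  (not necessarily proper) ancestor of \<^term>\<open>w\<close> iff it lies on that path.\<close>

definition ancestor :: "'a graph \<Rightarrow> 'a \<Rightarrow> 'a \<Rightarrow> 'a \<Rightarrow> bool" where
  "ancestor T r a w \<longleftrightarrow> (\<forall>xs. path_between T r w xs \<longrightarrow> a \<in> set xs)"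

definition children :: "'a graph \<Rightarrow> 'a \<Rightarrow> 'a \<Rightarrow> 'a set" where
  "children T r v = {u \<in> verts T. {v, u} \<in> edges T \<and> ancestor T r v u}"

definition parent :: "'a graph \<Rightarrow> 'a \<Rightarrow> 'a \<Rightarrow> 'a option" where
  "parent T r v = (if v = r then None else Some (THE u. v \<in> children T r u))"

definition subtree_verts :: "'a graph \<Rightarrow> 'a \<Rightarrow> 'a \<Rightarrow> 'a set" where
  "subtree_verts T r v = {w \<in> verts T. ancestor T r v w}"

definition subtree :: "'a graph \<Rightarrow> 'a \<Rightarrow> 'a \<Rightarrow> 'a graph" where
  "subtree T r v = induced T (subtree_verts T r v)"

definition subtree_plus :: "'a graph \<Rightarrow> 'a \<Rightarrow> 'a \<Rightarrow> 'a graph" where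
  "subtree_plus T r v = induced T (subtree_verts T r v \<union> set_option (parent T r v))"


section \<open>The procedure\<close>

lemma path_between_prefix:
  assumes "path_between T r w xs" "u \<in> set xs"
  obtains ys zs where "xs = ys @ u # zs" "path_between T r u (ys @ [u])"
proof -
  obtain ys zs where xs: "xs = ys @ u # zs"
    using assms(2) by (meson split_list)
  have "successively (\<lambda>x y. {x, y} \<in> edges T) ((ys @ [u]) @ zs)"
    using assms(1) by (simp add: xs path_between_def path_def)
  hence "successively (\<lambda>x y. {x, y} \<in> edges T) (ys @ [u])"
    unfolding successively_append_iff by blast
  hence "path_between T r u (ys @ [u])"
    using assms(1) by (auto simp: xs path_between_def path_def hd_append)
  with xs show ?thesis by (rule that)
qed

lemma child_subtree_verts_psubset:
  assumes T: "rooted_tree T r" and u: "u \<in> children T r v" and v: "v \<in> verts T"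
  shows "subtree_verts T r u \<subset> subtree_verts T r v"
proof -
  have anc: "ancestor T r v u" and e: "{v, u} \<in> edges T"
    using u by (auto simp: children_def)
  have "u \<noteq> v"
    using e T by (fastforce simp: rooted_tree_def tree_def forest_def simple_graph_def)
  have sub: "subtree_verts T r u \<subseteq> subtree_verts T r v"
  proof
    fix w assume w: "w \<in> subtree_verts T r u"
    have "v \<in> set xs" if xs: "path_between T r w xs" for xs
    proof -
      have "u \<in> set xs" using w xs by (auto simp: subtree_verts_def ancestor_def)
      with xs obtain ys zs where "xs = ys @ u # zs" "path_between T r u (ys @ [u])"
        by (rule path_between_prefix)
      thus ?thesis using anc \<open>u \<noteq> v\<close> by (auto simp: ancestor_def)
    qed
    thus "w \<in> subtree_verts T r v" using w by (auto simp: subtree_verts_def ancestor_def)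
  qed
  have "v \<in> subtree_verts T r v"
    using v by (auto simp: subtree_verts_def ancestor_def path_between_def path_def)
  moreover have "v \<notin> subtree_verts T r u"
  proof
    assume "v \<in> subtree_verts T r u"
    hence a: "ancestor T r u v" by (simp add: subtree_verts_def)
    obtain xs where xs: "path_between T r v xs"
      using T v by (auto simp: rooted_tree_def tree_def connected_def)
    with a have "u \<in> set xs" by (simp add: ancestor_def)
    with xs obtain ys zs where d: "xs = ys @ u # zs" "path_between T r u (ys @ [u])"
      by (rule path_between_prefix)
    have "v \<in> set ys" using anc d(2) \<open>u \<noteq> v\<close> by (fastforce simp: ancestor_def)
    moreover have "v \<in> set (u # zs)"
      using xs d(1) by (auto simp: path_between_def split: if_splits)
    ultimately show False using xs d(1) by (auto simp: path_between_def path_def)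
  qed
  ultimately show ?thesis using sub by blast
qed

text \<open>The first guard only makes the recursion total on arguments that are not vertices of a
  rooted tree. The recursive calls do not see the accumulated set, so the loop over the children
  amounts to a union. The empty parent is \<^term>\<open>None\<close>.\<close>

function claw_deletion_set_proc :: "'a graph \<Rightarrow> 'a \<Rightarrow> 'a \<Rightarrow> 'a option \<Rightarrow> 'a set" where
  "claw_deletion_set_proc T r v p =
     (if \<not> (rooted_tree T r \<and> v \<in> verts T) then {}
      else if children T r v = {} then {}
      else
        let S = (\<Union>u\<in>children T r v. claw_deletion_set_proc T r u (Some v));
            c = card (children T r v - S)
        in if 3 \<le> c then S \<union> {v}
           else if c = 2 \<and> p \<noteq> None \<and> v \<notin> S then S \<union> {the p}
           else S)"
  by pat_completeness auto
termination
proof (relation "measure (\<lambda>(T, r, v, p). card (subtree_verts T r v))", goal_cases)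
  case (2 T r v p u)
  have "finite (subtree_verts T r v)"
    using 2 by (auto simp: subtree_verts_def rooted_tree_def tree_def forest_def simple_graph_def)
  thus ?case using 2 child_subtree_verts_psubset[of T r u v]
    by (auto intro: psubset_card_mono)
qed simp

declare claw_deletion_set_proc.simps [simp del]


section \<open>Linear time\<close>

text \<open>Time is measured on a unit-cost random access machine over the natural numbers with
  constants, addition, (truncated) subtraction and indirect addressing, programmed with structured
  control flow. A state consists of the registers and the memory. Each elementary instruction and
  each evaluation of a test takes one time unit.\<close>

datatype ram_prog =
    Skip
  | Const nat nat
  | Add nat nat nat
  | Sub nat nat nat
  | Load nat nat
  | Store nat nat
  | Seq ram_prog ram_prog
  | IfNz nat ram_prog ram_prog
  | WhileNz nat ram_prog

type_synonym ram_state = "(nat \<Rightarrow> nat) \<times> (nat \<Rightarrow> nat)"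

inductive ram_exec :: "ram_prog \<Rightarrow> ram_state \<Rightarrow> nat \<Rightarrow> ram_state \<Rightarrow> bool" where
  "ram_exec Skip s 1 s"
| "ram_exec (Const i c) (R, M) 1 (R(i := c), M)"
| "ram_exec (Add i j k) (R, M) 1 (R(i := R j + R k), M)"
| "ram_exec (Sub i j k) (R, M) 1 (R(i := R j - R k), M)"
| "ram_exec (Load i j) (R, M) 1 (R(i := M (R j)), M)"
| "ram_exec (Store i j) (R, M) 1 (R, M(R i := R j))"
| "ram_exec P s t s' \<Longrightarrow> ram_exec Q s' t' s'' \<Longrightarrow> ram_exec (Seq P Q) s (t + t') s''"
| "fst s i \<noteq> 0 \<Longrightarrow> ram_exec P s t s' \<Longrightarrow> ram_exec (IfNz i P Q) s (1 + t) s'"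
| "fst s i = 0 \<Longrightarrow> ram_exec Q s t s' \<Longrightarrow> ram_exec (IfNz i P Q) s (1 + t) s'"
| "fst s i = 0 \<Longrightarrow> ram_exec (WhileNz i P) s 1 s"
| "fst s i \<noteq> 0 \<Longrightarrow> ram_exec P s t s' \<Longrightarrow> ram_exec (WhileNz i P) s' t' s'' \<Longrightarrow>
     ram_exec (WhileNz i P) s (1 + t + t') s''"

definition ram_init :: "nat list \<Rightarrow> ram_state" where
  "ram_init xs = (\<lambda>_. 0, \<lambda>i. if i < length xs then xs ! i else 0)"

text \<open>\<^term>\<open>enc xs x\<close> says that the word \<^term>\<open>xs\<close> is an encoding of the instance \<^term>\<open>x\<close>.
  The answer is delivered in register 0.\<close>

definition linear_time_decidable ::
    "(nat list \<Rightarrow> 'i \<Rightarrow> bool) \<Rightarrow> ('i \<Rightarrow> bool) \<Rightarrow> ('i \<Rightarrow> bool) \<Rightarrow> bool" where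
  "linear_time_decidable enc inst yes \<longleftrightarrow>
     (\<exists>P c. \<forall>x xs. inst x \<longrightarrow> enc xs x \<longrightarrow>
        (\<exists>t R M. ram_exec P (ram_init xs) t (R, M) \<and> t \<le> c * (length xs + 1) \<and>
           R 0 = (if yes x then 1 else 0)))"

text \<open>Adjacency-list encoding of a graph with vertices \<open>0, \<dots>, n - 1\<close> together with a number
  \<^term>\<open>k\<close>: the number of vertices, \<^term>\<open>k\<close>, and then, vertex by vertex, the degree followed by
  the neighbours in arbitrary order. The length of the encoding is \<open>2 + |V| + 2 |E|\<close>.\<close>

definition adj_list_encoding :: "nat list \<Rightarrow> nat graph \<times> nat \<Rightarrow> bool" where
  "adj_list_encoding xs = (\<lambda>(G, k). \<exists>adj.
     verts G = {..<length adj} \<and>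
     (\<forall>i<length adj. distinct (adj ! i) \<and> set (adj ! i) = {j. {i, j} \<in> edges G}) \<and>
     xs = length adj # k # concat (map (\<lambda>ns. length ns # ns) adj))"

definition linear_forest_deletion_instance :: "nat graph \<times> nat \<Rightarrow> bool" where
  "linear_forest_deletion_instance = (\<lambda>(F, k). forest F \<and> 0 < k)"

definition linear_forest_deletion_yes :: "nat graph \<times> nat \<Rightarrow> bool" where
  "linear_forest_deletion_yes = (\<lambda>(F, k).
     \<exists>S\<subseteq>verts F. card S \<le> k \<and> linear_forest (delete_verts F S))"

end

theory Submission
  imports Defs
begin

text \<open>A forest is claw-free iff all its degrees are at most 2, and iff it is a linear forest, so a
  claw-deletion set is a set of vertices whose removal leaves maximum degree at most 2.

  The set computed by the procedure is minimum because it comes with equally many disjoint stars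
  \<open>K\<^sub>1\<^sub>,\<^sub>3\<close>, each of which meets every deletion set. A vertex \<open>x\<close> is deleted because it has three
  kept children, or because it has a kept child with exactly two kept children; either way \<open>x\<close> lies
  in a star whose other vertices are kept descendants of \<open>x\<close> at depth at most 2, and \<open>x\<close> is the
  nearest deleted ancestor of each of them. Hence these stars are disjoint. The two additional
  claims hold because the stars are local: if the parent of \<open>v\<close> is not deleted, all stars lie in
  \<open>T\<^sub>v\<close>, and if moreover \<open>v\<close> is not deleted, they lie in \<open>T\<^sub>v - v\<close>.

  For linear time, leaves are peeled off instead of recursing from a root. Each vertex carries a
  weight, the number of its kept neighbours among those already peeled off, and weight at least 3
  means that it must be deleted. Peeling a leaf of weight \<open>c\<close> adds to its neighbour 0 if
  \<open>c \<ge> 3\<close> (the leaf is deleted), 3 if \<open>c = 2\<close> (the neighbour is deleted), and 1 otherwise. This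
  preserves the weighted minimum, and when no edge is left, the vertices of weight at least 3 are
  counted.\<close>

section \<open>Neighbours\<close>

definition nbrs :: "'a set set \<Rightarrow> 'a \<Rightarrow> 'a set" where
  "nbrs E v = {u. {v, u} \<in> E}"

abbreviation degree :: "'a set set \<Rightarrow> 'a \<Rightarrow> nat" where
  "degree E v \<equiv> card (nbrs E v)"

lemma mem_nbrs_commute: "u \<in> nbrs E v \<longleftrightarrow> v \<in> nbrs E u"
  by (simp add: nbrs_def insert_commute)

lemma nbrs_mono: "E \<subseteq> E' \<Longrightarrow> nbrs E v \<subseteq> nbrs E' v"
  by (auto simp: nbrs_def)

lemma nbrs_subset_verts: "simple_graph G \<Longrightarrow> nbrs (edges G) v \<subseteq> verts G"
  by (auto simp: nbrs_def simple_graph_def)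

lemma finite_nbrs: "simple_graph G \<Longrightarrow> finite (nbrs (edges G) v)"
  by (meson finite_subset nbrs_subset_verts simple_graph_def)

lemma self_notin_nbrs: "simple_graph G \<Longrightarrow> v \<notin> nbrs (edges G) v"
  by (fastforce simp: nbrs_def simple_graph_def)

lemma nbrs_induced: "v \<in> X \<Longrightarrow> nbrs (edges (induced G X)) v = nbrs (edges G) v \<inter> X"
  by (auto simp: nbrs_def induced_def)

lemma finite_edges: "simple_graph G \<Longrightarrow> finite (edges G)"
  by (rule finite_subset[of _ "Pow (verts G)"]) (auto simp: simple_graph_def)

lemma simple_graph_edgeE:
  assumes "simple_graph G" "e \<in> edges G"
  obtains u v where "e = {u, v}" "u \<noteq> v" "u \<in> verts G" "v \<in> verts G"
proof -
  have "card e = 2" "e \<subseteq> verts G" using assms by (auto simp: simple_graph_def)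
  then show ?thesis using that by (auto simp: card_2_iff)
qed

lemma incident_edgeE:
  assumes "simple_graph G" "e \<in> edges G" "v \<in> e"
  obtains u where "u \<in> nbrs (edges G) v" "e = {v, u}"
proof -
  obtain a b where "e = {a, b}" using assms(1,2) by (rule simple_graph_edgeE)
  with assms(3) have "e = {v, a} \<or> e = {v, b}" by auto
  then show ?thesis using that assms(2) by (auto simp: nbrs_def)
qed

lemma sum_degree:
  assumes "simple_graph G"
  shows "(\<Sum>v\<in>verts G. degree (edges G) v) = 2 * card (edges G)"
proof -
  have "degree (edges G) v = card {e \<in> edges G. v \<in> e}" for v
  proof (rule bij_betw_same_card[of "\<lambda>u. {v, u}"])
    have "{e \<in> edges G. v \<in> e} \<subseteq> (\<lambda>u. {v, u}) ` nbrs (edges G) v"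
      by (auto elim: incident_edgeE[OF assms])
    then show "bij_betw (\<lambda>u. {v, u}) (nbrs (edges G) v) {e \<in> edges G. v \<in> e}"
      by (auto simp: bij_betw_def inj_on_def nbrs_def doubleton_eq_iff)
  qed
  moreover have "card {v \<in> verts G. v \<in> e} = 2" if "e \<in> edges G" for e
    using that assms Int_absorb1[of e "verts G"]
    by (simp add: simple_graph_def Collect_conj_eq Int_commute)
  ultimately show ?thesis
    using sum_multicount[of "verts G" "edges G" "\<lambda>v e. v \<in> e" 2] assms finite_edges[OF assms]
    by (simp add: simple_graph_def)
qed

lemma simple_graph_induced: "simple_graph G \<Longrightarrow> simple_graph (induced G X)"
  by (auto simp: simple_graph_def induced_def)

lemma induced_verts: "simple_graph G \<Longrightarrow> induced G (verts G) = G"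
  by (cases G) (auto simp: induced_def simple_graph_def)

lemma delete_verts_induced:
  "X \<subseteq> verts G \<Longrightarrow> delete_verts (induced G X) S = induced G (X - S)"
  by (auto simp: induced_def delete_verts_def)

lemma verts_delete_verts: "verts (delete_verts G S) = verts G - S"
  by (auto simp: delete_verts_def induced_def)

lemma edges_delete_verts:
  "simple_graph G \<Longrightarrow> edges (delete_verts G S) = {e \<in> edges G. e \<inter> S = {}}"
  by (auto simp: delete_verts_def induced_def simple_graph_def)

section \<open>Forests\<close>

lemma forest_imp_simple_graph: "forest G \<Longrightarrow> simple_graph G"
  by (simp add: forest_def)

lemma forest_subgraph:
  assumes "forest G" "verts H \<subseteq> verts G" "edges H \<subseteq> edges G" "simple_graph H"
  shows "forest H"
proof -
  have "successively (\<lambda>x y. {x, y} \<in> edges G) xs"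
    if "successively (\<lambda>x y. {x, y} \<in> edges H) xs" for xs
    using that by (rule successively_mono) (use assms(3) in auto)
  then show ?thesis using assms by (fastforce simp: forest_def cycle_def path_def)
qed

lemma forest_induced: "forest G \<Longrightarrow> forest (induced G X)"
  by (rule forest_subgraph) (auto simp: induced_def simple_graph_def forest_def)

lemma forest_delete_verts: "forest G \<Longrightarrow> forest (delete_verts G S)"
  by (simp add: delete_verts_def forest_induced)

lemma forest_no_triangle:
  assumes "forest G" "a \<in> nbrs (edges G) v" "b \<in> nbrs (edges G) v"
  shows "{a, b} \<notin> edges G"
proof
  assume "{a, b} \<in> edges G"
  moreover have "simple_graph G" by (rule forest_imp_simple_graph) fact
  ultimately have "cycle G [v, a, b]"
    using assms(2,3) unfolding cycle_def path_def nbrs_def simple_graph_def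
    by (fastforce simp: insert_commute)
  then show False using assms(1) by (auto simp: forest_def)
qed

lemma exists_longest_path:
  assumes "simple_graph G" "path G ys"
  obtains xs where "path G xs" "length ys \<le> length xs" "\<And>zs. path G zs \<Longrightarrow> length zs \<le> length xs"
proof -
  have "length zs < Suc (card (verts G))" if "path G zs" for zs
    using that assms(1) by (metis card_mono distinct_card le_imp_less_Suc path_def simple_graph_def)
  then show ?thesis
    using ex_has_greatest_nat[of "path G" ys length] assms(2) that by blast
qed

lemma path_take_Suc:
  assumes "path G xs"
  shows "path G (take (Suc n) xs)"
proof -
  have "successively (\<lambda>x y. {x, y} \<in> edges G) (take (Suc n) xs @ drop (Suc n) xs)"
    using assms by (simp add: path_def)
  then have "successively (\<lambda>x y. {x, y} \<in> edges G) (take (Suc n) xs)"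
    unfolding successively_append_iff by blast
  then show ?thesis using assms set_take_subset[of "Suc n" xs] by (auto simp: path_def)
qed

lemma nbr_of_longest_path_hd:
  assumes "forest G" "path G xs" "\<And>zs. path G zs \<Longrightarrow> length zs \<le> length xs"
    and u: "{hd xs, u} \<in> edges G"
  shows "u = xs ! 1"
proof -
  have simple: "simple_graph G" by (rule forest_imp_simple_graph) fact
  have "xs \<noteq> []" using assms(2) by (simp add: path_def)
  have "u \<in> set xs"
  proof (rule ccontr)
    assume "u \<notin> set xs"
    then have "path G (u # xs)"
      using assms(2) u simple
      by (auto simp: path_def successively_Cons insert_commute simple_graph_def)
    then show False using assms(3) by fastforce
  qed
  then obtain j where j: "j < length xs" "u = xs ! j" by (auto simp: in_set_conv_nth)
  have "j \<noteq> 0"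
    using u j \<open>xs \<noteq> []\<close> self_notin_nbrs[OF simple, of u]
    by (auto simp: nbrs_def hd_conv_nth intro: ccontr)
  moreover have "\<not> 2 \<le> j"
  proof
    assume "2 \<le> j"
    moreover have "last (take (Suc j) xs) = u" using j by (simp add: take_Suc_conv_app_nth)
    ultimately have "cycle G (take (Suc j) xs)"
      using j u assms(2) by (simp add: cycle_def path_take_Suc insert_commute)
    then show False using assms(1) by (auto simp: forest_def)
  qed
  ultimately have "j = 1" by simp
  then show ?thesis using j by simp
qed

lemma forest_obtain_leaf:
  assumes "forest G" "edges G \<noteq> {}"
  obtains v where "v \<in> verts G" "degree (edges G) v = 1"
proof -
  have simple: "simple_graph G" by (rule forest_imp_simple_graph) fact
  obtain a b where "{a, b} \<in> edges G" "a \<noteq> b"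
    using assms(2) simple_graph_edgeE[OF simple] by (metis ex_in_conv)
  then have "path G [a, b]" using simple by (auto simp: path_def simple_graph_def)
  then obtain xs where xs: "path G xs" "2 \<le> length xs" "\<And>zs. path G zs \<Longrightarrow> length zs \<le> length xs"
    using exists_longest_path[OF simple] by (metis One_nat_def Suc_1 length_Cons list.size(3))
  have "nbrs (edges G) (hd xs) \<subseteq> {xs ! 1}"
    using nbr_of_longest_path_hd[OF assms(1) xs(1,3)] by (auto simp: nbrs_def)
  moreover have "xs ! 1 \<in> nbrs (edges G) (hd xs)"
    using xs by (cases xs; cases "tl xs") (auto simp: path_def nbrs_def)
  ultimately have "nbrs (edges G) (hd xs) = {xs ! 1}" by auto
  moreover have "hd xs \<in> verts G" using xs by (auto simp: path_def)
  ultimately show ?thesis using that by simp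
qed

lemma forest_induct [consumes 1, case_names empty remove]:
  assumes "forest G"
    and empty: "\<And>G. forest G \<Longrightarrow> verts G = {} \<Longrightarrow> P G"
    and remove: "\<And>G v. forest G \<Longrightarrow> v \<in> verts G \<Longrightarrow> degree (edges G) v \<le> 1 \<Longrightarrow>
      P (delete_verts G {v}) \<Longrightarrow> P G"
  shows "P G"
  using assms(1)
proof (induction "card (verts G)" arbitrary: G rule: less_induct)
  case less
  have finite: "finite (verts G)" using less.prems by (simp add: forest_def simple_graph_def)
  show ?case
  proof (cases "verts G = {}")
    case False
    then obtain u where "u \<in> verts G" by auto
    moreover have "degree (edges G) u = 0" if "edges G = {}" using that by (simp add: nbrs_def)
    ultimately obtain v where v: "v \<in> verts G" "degree (edges G) v \<le> 1"
      using forest_obtain_leaf[OF less.prems] by (metis le_refl zero_le_one)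
    have "P (delete_verts G {v})"
      using card_Diff1_less[OF finite v(1)] less.prems
      by (intro less.hyps) (simp_all add: verts_delete_verts forest_delete_verts)
    then show ?thesis by (rule remove[OF less.prems v])
  qed (rule empty[OF less.prems])
qed

lemma forest_card_edges_le: "forest G \<Longrightarrow> card (edges G) \<le> card (verts G)"
proof (induction rule: forest_induct)
  case (empty G)
  then have "edges G = {}" by (fastforce simp: forest_def simple_graph_def)
  then show ?case by simp
next
  case (remove G v)
  let ?H = "delete_verts G {v}" and ?N = "nbrs (edges G) v"
  have simple: "simple_graph G" by (rule forest_imp_simple_graph) fact
  have "edges G \<subseteq> edges ?H \<union> (\<lambda>u. {v, u}) ` ?N"
    by (auto simp: edges_delete_verts[OF simple] elim: incident_edgeE[OF simple])
  then have "card (edges G) \<le> card (edges ?H \<union> (\<lambda>u. {v, u}) ` ?N)"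
    using finite_edges[OF simple] finite_nbrs[OF simple]
    by (intro card_mono) (simp_all add: edges_delete_verts[OF simple])
  also have "\<dots> \<le> card (edges ?H) + card ((\<lambda>u. {v, u}) ` ?N)" by (rule card_Un_le)
  also have "\<dots> \<le> card (verts ?H) + degree (edges G) v"
    using remove.IH card_image_le[OF finite_nbrs[OF simple]] by (rule add_mono)
  also have "\<dots> \<le> card (verts G - {v}) + 1" using remove.hyps by (simp add: verts_delete_verts)
  also have "\<dots> = card (verts G)"
    using remove.hyps(2) simple card_Suc_Diff1[of "verts G" v] by (simp add: simple_graph_def)
  finally show ?case .
qed

lemma successively_append_overlap:
  "successively P (xs @ y # zs) \<longleftrightarrow> successively P (xs @ [y]) \<and> successively P (y # zs)"
  by (auto simp: successively_append_iff successively_Cons)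

lemma cycle_if_paths_meet:
  assumes "path_between G x w xs" "path_between G y w ys" "x \<noteq> y"
    and "{u, x} \<in> edges G" "{u, y} \<in> edges G" "u \<in> verts G" "u \<notin> set xs" "u \<notin> set ys"
  shows "\<exists>c. cycle G c"
proof -
  let ?adj = "\<lambda>x y. {x, y} \<in> edges G"
  have xs: "xs \<noteq> []" "hd xs = x" "distinct xs" "set xs \<subseteq> verts G" "successively ?adj xs"
    and ys: "ys \<noteq> []" "hd ys = y" "distinct ys" "set ys \<subseteq> verts G" "successively ?adj ys"
    using assms(1,2) by (auto simp: path_between_def path_def)
  have "\<exists>b\<in>set xs. b \<in> set ys"
    using assms(1,2) by (metis last_in_set path_between_def path_def)
  then obtain as b bs where xs_split: "xs = as @ b # bs" "b \<in> set ys" "\<forall>z\<in>set as. z \<notin> set ys"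
    using split_list_first_prop[of xs "\<lambda>b. b \<in> set ys"] by blast
  obtain cs ds where ys_split: "ys = cs @ b # ds" using xs_split(2) by (meson split_list)
  let ?c = "u # as @ b # rev cs"
  have "successively ?adj (as @ [b])"
    using xs(5) unfolding xs_split(1) successively_append_overlap[of _ as b bs] by blast
  then have "successively ?adj (u # as @ [b])"
    using assms(4) xs(2) xs_split(1) by (cases as) auto
  moreover have "successively ?adj (cs @ [b])"
    using ys(5) unfolding ys_split successively_append_overlap[of _ cs b ds] by blast
  then have "successively ?adj (b # rev cs)"
    using successively_rev[of ?adj "cs @ [b]"] by (simp add: insert_commute)
  ultimately have "successively ?adj ?c"
    using successively_append_overlap[of ?adj "u # as" b "rev cs"] by simp
  then have "path G ?c"
    using assms(6-8) xs(3,4) ys(3,4) xs_split ys_split by (auto simp: path_def)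
  moreover have "last ?c = y" using ys(2) ys_split by (cases cs) auto
  moreover have "3 \<le> length ?c"
    using assms(3) xs(2) ys(2) xs_split(1) ys_split by (cases as; cases cs) auto
  ultimately have "cycle G ?c" using assms(5) by (simp add: cycle_def insert_commute)
  then show ?thesis ..
qed

lemma forest_path_unique:
  assumes "forest G" "path_between G u w xs" "path_between G u w ys"
  shows "xs = ys"
  using assms(2,3)
proof (induction xs arbitrary: u ys)
  case (Cons a xs)
  obtain ys' where ys: "ys = u # ys'" and a: "a = u"
    using Cons.prems unfolding path_between_def path_def by (metis list.collapse list.sel(1))
  have u: "u \<notin> set xs" "u \<notin> set ys'" "u \<in> verts G"
    using Cons.prems a ys by (auto simp: path_between_def path_def)
  show ?case
  proof (cases "xs = [] \<or> ys' = []")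
    case True
    then show ?thesis using Cons.prems a ys u
      by (auto simp: path_between_def split: if_splits)
  next
    case False
    then have tails: "path_between G (hd xs) w xs" "path_between G (hd ys') w ys'"
      and edges: "{u, hd xs} \<in> edges G" "{u, hd ys'} \<in> edges G"
      using Cons.prems a ys by (auto simp: path_between_def path_def successively_Cons)
    have "hd xs = hd ys'"
      using cycle_if_paths_meet[OF tails _ edges u(3,1,2)] assms(1) by (auto simp: forest_def)
    then show ?thesis using Cons.IH[OF tails(1)] tails(2) a ys by simp
  qed
qed (simp add: path_between_def path_def)

section \<open>Claw-free forests and linear forests\<close>

lemma graph_iso_claw_iff:
  assumes "simple_graph G"
  shows "graph_iso G claw \<longleftrightarrow> (\<exists>v a b c. distinct [v, a, b, c] \<and> verts G = {v, a, b, c} \<and>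
    edges G = {{v, a}, {v, b}, {v, c}})"
proof
  assume "graph_iso G claw"
  then obtain f where f: "bij_betw f (verts G) {0, 1, 2, 3::nat}"
    and edges: "(\<lambda>e. f ` e) ` edges G = {{0, 1}, {0, 2}, {0, 3}}"
    by (auto simp: graph_iso_def claw_def)
  define g where "g = inv_into (verts G) f"
  have g: "inj_on g {0, 1, 2, 3}" "g ` {0, 1, 2, 3} = verts G"
    using bij_betw_inv_into[OF f] by (simp_all add: bij_betw_def g_def)
  have "g ` f ` e = e" if "e \<in> edges G" for e
    unfolding g_def using f that assms
    by (intro inv_into_image_cancel) (auto simp: bij_betw_def simple_graph_def)
  then have "edges G = (\<lambda>e. g ` e) ` (\<lambda>e. f ` e) ` edges G" by (simp add: image_image)
  also have "\<dots> = {{g 0, g 1}, {g 0, g 2}, {g 0, g 3}}" by (simp add: edges)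
  finally have "edges G = {{g 0, g 1}, {g 0, g 2}, {g 0, g 3}}" .
  moreover have "distinct [g 0, g 1, g 2, g 3]" using g(1) by (simp add: inj_on_eq_iff)
  moreover have "verts G = {g 0, g 1, g 2, g 3}" using g(2) by simp
  ultimately show "\<exists>v a b c. distinct [v, a, b, c] \<and> verts G = {v, a, b, c} \<and>
      edges G = {{v, a}, {v, b}, {v, c}}" by blast
next
  assume "\<exists>v a b c. distinct [v, a, b, c] \<and> verts G = {v, a, b, c} \<and>
    edges G = {{v, a}, {v, b}, {v, c}}"
  then obtain v a b c where distinct: "distinct [v, a, b, c]"
    and G: "verts G = {v, a, b, c}" "edges G = {{v, a}, {v, b}, {v, c}}" by blast
  define f :: "'a \<Rightarrow> nat" where
    "f = (\<lambda>_. 3)(v := 0, a := 1, b := 2)"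
  have f: "f v = 0" "f a = 1" "f b = 2" "f c = 3" using distinct by (auto simp: f_def)
  then have "bij_betw f (verts G) (verts claw)"
    by (auto simp: G bij_betw_def inj_on_def claw_def)
  moreover have "edges claw = (\<lambda>e. f ` e) ` edges G" by (simp add: f G claw_def)
  ultimately show "graph_iso G claw" unfolding graph_iso_def by blast
qed

lemma claw_free_if_degree_le_2:
  assumes "simple_graph G" "\<And>v. v \<in> verts G \<Longrightarrow> degree (edges G) v \<le> 2"
  shows "claw_free G"
  unfolding claw_free_def
proof
  assume "\<exists>X\<subseteq>verts G. graph_iso (induced G X) claw"
  then obtain X v a b c where "X \<subseteq> verts G" "distinct [v, a, b, c]"
    "verts (induced G X) = {v, a, b, c}" "edges (induced G X) = {{v, a}, {v, b}, {v, c}}"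
    using graph_iso_claw_iff[OF simple_graph_induced[OF assms(1)]] by metis
  then have "distinct [a, b, c]" "v \<in> verts G" "{a, b, c} \<subseteq> nbrs (edges G) v"
    by (auto simp: induced_def nbrs_def)
  moreover from this have "card {a, b, c} \<le> degree (edges G) v"
    by (intro card_mono finite_nbrs assms(1))
  ultimately show False using assms(2)[of v] by simp
qed

lemma degree_le_2_if_claw_free:
  assumes "forest G" "claw_free G" "v \<in> verts G"
  shows "degree (edges G) v \<le> 2"
proof (rule ccontr)
  have simple: "simple_graph G" by (rule forest_imp_simple_graph) fact
  assume "\<not> ?thesis"
  then obtain A where "A \<subseteq> nbrs (edges G) v" "card A = 3"
    by (metis not_less_eq_eq numeral_2_eq_2 numeral_3_eq_3 obtain_subset_with_card_n)
  then obtain a b c where abc: "a \<in> nbrs (edges G) v" "b \<in> nbrs (edges G) v" "c \<in> nbrs (edges G) v"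
    and distinct: "distinct [a, b, c]" by (auto simp: card_3_iff)
  let ?X = "{v, a, b, c}"
  have v: "v \<notin> {a, b, c}" using abc self_notin_nbrs[OF simple] by auto
  have X: "?X \<subseteq> verts G" using assms(3) abc nbrs_subset_verts[OF simple] by auto
  have "edges (induced G ?X) \<subseteq> {{v, a}, {v, b}, {v, c}}"
  proof
    fix e assume "e \<in> edges (induced G ?X)"
    then have e: "e \<in> edges G" "e \<subseteq> ?X" by (auto simp: induced_def)
    moreover obtain x y where "e = {x, y}" "x \<noteq> y"
      using e(1) by (rule simple_graph_edgeE[OF simple])
    moreover have "{a, b} \<notin> edges G" "{a, c} \<notin> edges G" "{b, c} \<notin> edges G"
      using abc forest_no_triangle[OF assms(1)] by auto
    ultimately show "e \<in> {{v, a}, {v, b}, {v, c}}" by (auto simp: insert_commute)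
  qed
  moreover have "{{v, a}, {v, b}, {v, c}} \<subseteq> edges (induced G ?X)"
    using abc by (auto simp: induced_def nbrs_def)
  ultimately have "edges (induced G ?X) = {{v, a}, {v, b}, {v, c}}" ..
  moreover have "verts (induced G ?X) = ?X" using X by (auto simp: induced_def)
  moreover have "distinct [v, a, b, c]" using v distinct by simp
  ultimately have "graph_iso (induced G ?X) claw"
    unfolding graph_iso_claw_iff[OF simple_graph_induced[OF simple]] by blast
  then show False using assms(2) X unfolding claw_free_def by blast
qed

lemma claw_free_iff_degree_le_2:
  "forest G \<Longrightarrow> claw_free G \<longleftrightarrow> (\<forall>v\<in>verts G. degree (edges G) v \<le> 2)"
  by (meson claw_free_if_degree_le_2 degree_le_2_if_claw_free forest_imp_simple_graph)

definition path_edges :: "'a list \<Rightarrow> 'a set set" where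
  "path_edges xs = (\<lambda>i. {xs ! i, xs ! Suc i}) ` {i. Suc i < length xs}"

lemma path_graph_iff:
  "path_graph G \<longleftrightarrow> (\<exists>xs. xs \<noteq> [] \<and> distinct xs \<and> verts G = set xs \<and> edges G = path_edges xs)"
  unfolding path_graph_def path_edges_def setcompr_eq_image ..

lemma path_edges_Cons:
  assumes "xs \<noteq> []"
  shows "path_edges (x # xs) = insert {x, hd xs} (path_edges xs)"
proof -
  obtain n where n: "length xs = Suc n" using assms by (cases xs) auto
  have "{i. Suc i < length (x # xs)} = {..<Suc n}" "{i. Suc i < length xs} = {..<n}"
    by (auto simp: n)
  then have "{i. Suc i < length (x # xs)} = insert 0 (Suc ` {i. Suc i < length xs})"
    by (simp add: lessThan_Suc_eq_insert_0)
  then show ?thesis using assms unfolding path_edges_def by (simp add: image_image hd_conv_nth)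
qed

lemma path_edges_rev: "path_edges (rev xs) = path_edges xs"
proof -
  have "path_edges (rev xs) \<subseteq> path_edges xs" for xs :: "'a list"
  proof
    fix e assume "e \<in> path_edges (rev xs)"
    then obtain i where "e = {rev xs ! i, rev xs ! Suc i}" "Suc i < length xs"
      by (auto simp: path_edges_def)
    moreover define j where "j = length xs - Suc (Suc i)"
    ultimately have "e = {xs ! j, xs ! Suc j}" "Suc j < length xs"
      by (auto simp: rev_nth Suc_diff_Suc)
    then show "e \<in> path_edges xs" by (auto simp: path_edges_def)
  qed
  from this[of xs] this[of "rev xs"] show ?thesis by simp
qed

definition path_partition :: "'a graph \<Rightarrow> 'a set set \<Rightarrow> bool" where
  "path_partition G \<P> \<longleftrightarrow> partition_on (verts G) \<P> \<and>
     (\<forall>P\<in>\<P>. path_graph (induced G P)) \<and> (\<forall>e\<in>edges G. \<exists>P\<in>\<P>. e \<subseteq> P)"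

lemma linear_forest_iff_path_partition: "linear_forest G \<longleftrightarrow> (\<exists>\<P>. path_partition G \<P>)"
  by (simp add: linear_forest_def path_partition_def)

lemma path_partition_delete_vertsD:
  assumes "path_partition (delete_verts G S) \<P>" "P \<in> \<P>"
  shows "P \<subseteq> verts G - S" "path_graph (induced G P)"
proof -
  show subset: "P \<subseteq> verts G - S"
    using assms by (auto simp: path_partition_def partition_on_def verts_delete_verts)
  then have "induced (delete_verts G S) P = induced G P"
    by (auto simp: induced_def delete_verts_def)
  then show "path_graph (induced G P)" using assms by (metis path_partition_def)
qed

lemma linear_forest_insert_vertex:
  assumes simple: "simple_graph G" and v: "v \<in> verts G"
    and \<P>: "path_partition (delete_verts G {v}) \<P>"
    and Q: "Q \<in> insert {} \<P>" "nbrs (edges G) v \<subseteq> Q" "path_graph (induced G (insert v Q))"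
  shows "linear_forest G"
proof -
  have partition: "partition_on (verts G - {v}) \<P>"
    using \<P> by (simp add: path_partition_def verts_delete_verts)
  have disjoint: "disjnt Q (\<Union> (\<P> - {Q}))"
    using partition_onD2[OF partition] Q(1) by (auto simp: disjnt_def disjoint_def)
  have "partition_on (verts G - insert v Q) (\<P> - {Q})"
  proof (cases "Q \<in> \<P>")
    case True
    then have "insert Q (\<P> - {Q}) = \<P>" by auto
    moreover have "verts G - insert v Q = verts G - {v} - Q" by auto
    ultimately show ?thesis
      using partition partition_on_insert[OF disjoint, of "verts G - {v}"] by metis
  qed (use partition Q(1) in simp)
  moreover have "\<Union> \<P> = verts G - {v}" using partition by (simp add: partition_on_def)
  then have "disjnt (insert v Q) (\<Union> (\<P> - {Q}))" "insert v Q \<subseteq> verts G"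
    using disjoint v Q(1) by auto
  ultimately have "partition_on (verts G) (insert (insert v Q) (\<P> - {Q}))"
    by (simp add: partition_on_insert)
  moreover have "\<exists>P\<in>insert (insert v Q) (\<P> - {Q}). e \<subseteq> P" if e: "e \<in> edges G" for e
  proof (cases "v \<in> e")
    case True
    obtain u where "u \<in> nbrs (edges G) v" "e = {v, u}"
      using e True by (rule incident_edgeE[OF simple])
    then show ?thesis using Q(2) by (intro bexI[of _ "insert v Q"]) auto
  next
    case False
    then have "e \<in> edges (delete_verts G {v})" using e by (simp add: edges_delete_verts[OF simple])
    then obtain P where "P \<in> \<P>" "e \<subseteq> P" using \<P> unfolding path_partition_def by blast
    then show ?thesis by (cases "P = Q") auto
  qed
  ultimately have "path_partition G (insert (insert v Q) (\<P> - {Q}))"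
    using path_partition_delete_vertsD(2)[OF \<P>] Q(3) by (simp add: path_partition_def)
  then show ?thesis unfolding linear_forest_iff_path_partition ..
qed

lemma inner_path_nbrs:
  assumes "distinct xs" "0 < i" "Suc i < length xs"
  shows "{xs ! (i - 1), xs ! Suc i} \<subseteq> nbrs (path_edges xs) (xs ! i)"
    and "card {xs ! (i - 1), xs ! Suc i} = 2"
proof -
  have "{xs ! j, xs ! Suc j} \<in> path_edges xs" if "Suc j < length xs" for j
    using that by (auto simp: path_edges_def)
  from this[of i] this[of "i - 1"]
  show "{xs ! (i - 1), xs ! Suc i} \<subseteq> nbrs (path_edges xs) (xs ! i)"
    using assms(2,3) by (simp add: nbrs_def insert_commute)
  show "card {xs ! (i - 1), xs ! Suc i} = 2"
    using assms by (simp add: card_insert_if nth_eq_iff_index_eq)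
qed

lemma path_graph_obtain_hd:
  assumes simple: "simple_graph G" and Q: "Q \<subseteq> verts G" "path_graph (induced G Q)"
    and u: "u \<in> Q" "degree (edges G) u \<le> 2" and v: "v \<in> nbrs (edges G) u" "v \<notin> Q"
  obtains xs where "xs \<noteq> []" "distinct xs" "Q = set xs" "edges (induced G Q) = path_edges xs"
    "hd xs = u"
proof -
  obtain xs where xs: "xs \<noteq> []" "distinct xs" "Q = set xs" "edges (induced G Q) = path_edges xs"
    using Q by (auto simp: path_graph_iff induced_def Int_absorb1)
  obtain i where i: "i < length xs" "u = xs ! i" using u(1) xs(3) by (auto simp: in_set_conv_nth)
  have "\<not> (0 < i \<and> Suc i < length xs)"
  proof
    assume inner: "0 < i \<and> Suc i < length xs"
    let ?N = "{xs ! (i - 1), xs ! Suc i}"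
    have N: "?N \<subseteq> nbrs (edges (induced G Q)) u" "card ?N = 2"
      using inner_path_nbrs[OF xs(2), of i] inner i(2) xs(4) by auto
    have "xs ! (i - 1) \<in> Q" "xs ! Suc i \<in> Q" using xs(3) inner by auto
    then have "v \<notin> ?N" using v(2) by blast
    moreover have "nbrs (edges (induced G Q)) u \<subseteq> nbrs (edges G) u"
      by (auto simp: nbrs_def induced_def)
    then have "card (insert v ?N) \<le> degree (edges G) u"
      using N(1) v(1) by (intro card_mono finite_nbrs[OF simple]) auto
    ultimately show False using N(2) u(2) by simp
  qed
  then have "i = 0 \<or> i = length xs - 1" using i(1) by linarith
  then have "u = hd xs \<or> u = hd (rev xs)"
    using i(2) xs(1) by (auto simp: hd_rev hd_conv_nth last_conv_nth)
  then show thesis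
    using that[of xs] that[of "rev xs"] xs by (auto simp: path_edges_rev)
qed

lemma path_graph_insert_leaf:
  assumes simple: "simple_graph G" and v: "v \<in> verts G" "v \<notin> Q" "nbrs (edges G) v \<inter> Q = {u}"
    and u: "degree (edges G) u \<le> 2" and Q: "Q \<subseteq> verts G" "path_graph (induced G Q)"
  shows "path_graph (induced G (insert v Q))"
proof -
  have uv: "u \<in> nbrs (edges G) v" "v \<in> nbrs (edges G) u" "u \<in> Q"
    using v(3) mem_nbrs_commute[of u] by blast+
  obtain xs where xs: "xs \<noteq> []" "distinct xs" "Q = set xs" "edges (induced G Q) = path_edges xs"
    "hd xs = u"
    using path_graph_obtain_hd[OF simple Q uv(3) u uv(2) v(2)] .
  have "edges (induced G (insert v Q)) \<subseteq> insert {v, u} (edges (induced G Q))"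
  proof
    fix e assume "e \<in> edges (induced G (insert v Q))"
    then have e: "e \<in> edges G" "e \<subseteq> insert v Q" by (auto simp: induced_def)
    show "e \<in> insert {v, u} (edges (induced G Q))"
    proof (cases "v \<in> e")
      case True
      obtain x where "x \<in> nbrs (edges G) v" "e = {v, x}"
        using e(1) True by (rule incident_edgeE[OF simple])
      then have "x \<in> nbrs (edges G) v \<inter> Q" using e(2) self_notin_nbrs[OF simple, of v] by auto
      then show ?thesis using v(3) \<open>e = {v, x}\<close> by simp
    qed (use e in \<open>auto simp: induced_def\<close>)
  qed
  moreover have "insert {v, u} (edges (induced G Q)) \<subseteq> edges (induced G (insert v Q))"
    using uv by (auto simp: induced_def nbrs_def)
  ultimately have "edges (induced G (insert v Q)) = path_edges (v # xs)"
    using path_edges_Cons[OF xs(1), of v] xs(4,5) by auto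
  then show ?thesis
    using xs v Q(1) unfolding path_graph_iff by (intro exI[of _ "v # xs"]) (auto simp: induced_def)
qed

lemma linear_forest_insert_degree_le_1:
  assumes simple: "simple_graph G" and v: "v \<in> verts G" "degree (edges G) v \<le> 1"
    and degrees: "\<forall>u\<in>verts G. degree (edges G) u \<le> 2" and "linear_forest (delete_verts G {v})"
  shows "linear_forest G"
proof -
  obtain \<P> where \<P>: "path_partition (delete_verts G {v}) \<P>"
    using assms(5) by (auto simp: linear_forest_iff_path_partition)
  note insert_vertex = linear_forest_insert_vertex[OF simple v(1) \<P>]
  show ?thesis
  proof (cases "nbrs (edges G) v = {}")
    case True
    have "\<not> e \<subseteq> {v}" if "e \<in> edges G" for e
      using that by (rule simple_graph_edgeE[OF simple]) auto
    then have "edges (induced G {v}) = {}" by (auto simp: induced_def)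
    then have "path_graph (induced G {v})"
      using v(1) by (auto simp: path_graph_iff path_edges_def induced_def intro!: exI[of _ "[v]"])
    with True show ?thesis by (intro insert_vertex[of "{}"]) auto
  next
    case False
    then have "degree (edges G) v = 1"
      using v(2) finite_nbrs[OF simple] by (simp add: card_gt_0_iff order_antisym Suc_leI)
    then obtain u where u: "nbrs (edges G) v = {u}" by (rule card_1_singletonE)
    then have u_vert: "u \<in> verts G - {v}"
      using nbrs_subset_verts[OF simple] self_notin_nbrs[OF simple, of v] by auto
    moreover have "\<Union> \<P> = verts G - {v}"
      using \<P> by (simp add: path_partition_def partition_on_def verts_delete_verts)
    ultimately obtain Q where Q: "Q \<in> \<P>" "u \<in> Q" by blast
    note Q_path = path_partition_delete_vertsD[OF \<P> Q(1)]
    have "path_graph (induced G (insert v Q))"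
      using u Q(2) Q_path u_vert degrees
      by (intro path_graph_insert_leaf[OF simple v(1), of _ u]) auto
    then show ?thesis using insert_vertex[of Q] Q u by auto
  qed
qed

lemma linear_forest_if_degree_le_2:
  assumes "forest G" "\<forall>v\<in>verts G. degree (edges G) v \<le> 2"
  shows "linear_forest G"
  using assms
proof (induction rule: forest_induct)
  case (empty G)
  then have "edges G = {}" by (fastforce simp: forest_def simple_graph_def)
  with empty show ?case by (auto simp: linear_forest_def partition_on_def intro!: exI[of _ "{}"])
next
  case (remove G v)
  let ?H = "delete_verts G {v}"
  have simple: "simple_graph G" by (rule forest_imp_simple_graph) fact
  have "nbrs (edges ?H) u \<subseteq> nbrs (edges G) u" for u
    by (rule nbrs_mono) (auto simp: edges_delete_verts[OF simple])
  then have "degree (edges ?H) u \<le> degree (edges G) u" for u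
    by (intro card_mono finite_nbrs[OF simple])
  then have "\<forall>u\<in>verts ?H. degree (edges ?H) u \<le> 2"
    using remove.prems by (metis DiffD1 le_trans verts_delete_verts)
  then have "linear_forest ?H" by (rule remove.IH)
  then show ?case
    by (rule linear_forest_insert_degree_le_1[OF simple remove.hyps(2,3) remove.prems])
qed

lemma degree_le_2_if_linear_forest:
  assumes "linear_forest G" "v \<in> verts G"
  shows "degree (edges G) v \<le> 2"
proof -
  obtain \<P> where \<P>: "partition_on (verts G) \<P>" "\<forall>P\<in>\<P>. path_graph (induced G P)"
      "\<forall>e\<in>edges G. \<exists>P\<in>\<P>. e \<subseteq> P" using assms unfolding linear_forest_def by blast
  obtain Q where Q: "Q \<in> \<P>" "v \<in> Q" using \<P>(1) assms(2) by (auto simp: partition_on_def)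
  have "Q \<subseteq> verts G" using \<P>(1) Q by (auto simp: partition_on_def)
  then obtain xs where xs: "distinct xs" "Q = set xs" "edges (induced G Q) = path_edges xs"
    using bspec[OF \<P>(2) Q(1)] by (auto simp: path_graph_iff induced_def Int_absorb1)
  obtain i where i: "i < length xs" "v = xs ! i" using Q xs by (auto simp: in_set_conv_nth)
  have "nbrs (edges G) v \<subseteq> {xs ! (i - 1), xs ! Suc i}"
  proof
    fix u assume u: "u \<in> nbrs (edges G) v"
    then obtain Q' where Q': "Q' \<in> \<P>" "{v, u} \<subseteq> Q'" using \<P>(3) unfolding nbrs_def by blast
    then have "Q' = Q" using \<P>(1) Q by (auto simp: partition_on_def disjoint_def)
    then have "{v, u} \<in> path_edges xs" using Q' u xs(3) by (auto simp: induced_def nbrs_def)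
    then obtain j where j: "{v, u} = {xs ! j, xs ! Suc j}" "Suc j < length xs"
      by (auto simp: path_edges_def)
    then have "v = xs ! j \<and> u = xs ! Suc j \<or> v = xs ! Suc j \<and> u = xs ! j"
      by (auto simp: doubleton_eq_iff)
    then show "u \<in> {xs ! (i - 1), xs ! Suc i}"
      using i j(2) xs(1) by (auto simp: nth_eq_iff_index_eq)
  qed
  then have "degree (edges G) v \<le> card {xs ! (i - 1), xs ! Suc i}" by (intro card_mono) auto
  also have "\<dots> \<le> 2" by (simp add: card_insert_if)
  finally show ?thesis .
qed

lemma linear_forest_iff_claw_free: "forest G \<Longrightarrow> linear_forest G \<longleftrightarrow> claw_free G"
  by (meson claw_free_iff_degree_le_2 degree_le_2_if_linear_forest linear_forest_if_degree_le_2)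

section \<open>Deletion sets\<close>

text \<open>The weight of a vertex counts kept neighbours whose edges are no longer in \<open>E\<close>.\<close>

definition deletion_set :: "'a set \<Rightarrow> 'a set set \<Rightarrow> ('a \<Rightarrow> nat) \<Rightarrow> 'a set \<Rightarrow> bool" where
  "deletion_set V E w S \<longleftrightarrow> S \<subseteq> V \<and> (\<forall>v\<in>V - S. w v + card (nbrs E v \<inter> V - S) \<le> 2)"

definition star :: "'a set set \<Rightarrow> 'a set \<Rightarrow> bool" where
  "star E Q \<longleftrightarrow> (\<exists>v A. A \<subseteq> nbrs E v \<and> card A = 3 \<and> Q = insert v A)"

lemma deletion_set_Int:
  assumes "deletion_set X E w S" "Y \<subseteq> X" "finite X"
  shows "deletion_set Y E w (S \<inter> Y)"
  unfolding deletion_set_def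
proof (intro conjI ballI)
  fix v assume v: "v \<in> Y - S \<inter> Y"
  have "card (nbrs E v \<inter> Y - S \<inter> Y) \<le> card (nbrs E v \<inter> X - S)"
    using assms by (intro card_mono) auto
  moreover have "w v + card (nbrs E v \<inter> X - S) \<le> 2"
    using assms v by (auto simp: deletion_set_def)
  ultimately show "w v + card (nbrs E v \<inter> Y - S \<inter> Y) \<le> 2" by linarith
qed simp

lemma star_meets_deletion_set:
  assumes "star E Q" "Q \<subseteq> X" "deletion_set X E w S" "finite X"
  shows "S \<inter> Q \<noteq> {}"
proof
  assume disjoint: "S \<inter> Q = {}"
  obtain v A where A: "A \<subseteq> nbrs E v" "card A = 3" "Q = insert v A"
    using assms(1) by (auto simp: star_def)
  then have "card A \<le> card (nbrs E v \<inter> X - S)"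
    using disjoint assms(2,4) by (intro card_mono) auto
  moreover have "v \<in> X - S" using A(3) disjoint assms(2) by auto
  then have "w v + card (nbrs E v \<inter> X - S) \<le> 2" using assms(3) unfolding deletion_set_def by blast
  ultimately show False using A(2) by simp
qed

text \<open>The function \<open>f\<close> keeps the stars of different vertices disjoint.\<close>

lemma card_le_card_deletion_set:
  assumes "deletion_set X E w S'" "finite X"
    and stars: "\<And>x. x \<in> S \<Longrightarrow> \<exists>Q\<subseteq>X. star E Q \<and> f ` Q \<subseteq> {x}"
  shows "card S \<le> card S'"
proof (rule surj_card_le)
  show "finite S'" using assms(1,2) finite_subset by (auto simp: deletion_set_def)
  show "S \<subseteq> f ` S'"
  proof
    fix x assume "x \<in> S"
    then obtain Q where "Q \<subseteq> X" "star E Q" and owned: "f ` Q \<subseteq> {x}" using stars by blast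
    then obtain z where "z \<in> S'" "z \<in> Q" using star_meets_deletion_set[OF _ _ assms(1,2)] by blast
    then show "x \<in> f ` S'" using owned by blast
  qed
qed

lemma claw_deletion_set_induced_iff:
  assumes "forest G" "X \<subseteq> verts G"
  shows "claw_deletion_set (induced G X) S \<longleftrightarrow> deletion_set X (edges G) (\<lambda>_. 0) S"
proof -
  have "verts (induced G X) = X" "verts (induced G (X - S)) = X - S"
    using assms(2) by (auto simp: induced_def)
  moreover have "nbrs (edges G) v \<inter> (X - S) = nbrs (edges G) v \<inter> X - S" for v by auto
  ultimately show ?thesis
    using assms by (auto simp: claw_deletion_set_def deletion_set_def delete_verts_induced
        claw_free_iff_degree_le_2 forest_induced nbrs_induced)
qed

lemma cdn_induced_le:
  assumes "forest G" "X \<subseteq> verts G" "deletion_set X (edges G) (\<lambda>_. 0) S"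
  shows "cdn (induced G X) \<le> card S"
  unfolding cdn_def
  by (rule Least_le) (use assms in \<open>auto simp: claw_deletion_set_induced_iff\<close>)

lemma card_le_cdn_induced:
  assumes "forest G" "X \<subseteq> verts G"
    and stars: "\<And>x. x \<in> S \<Longrightarrow> \<exists>Q\<subseteq>X. star (edges G) Q \<and> f ` Q \<subseteq> {x}"
  shows "card S \<le> cdn (induced G X)"
proof -
  have finite: "finite X" using assms(1,2) finite_subset by (auto simp: forest_def simple_graph_def)
  have "claw_deletion_set (induced G X) X"
    using assms by (simp add: claw_deletion_set_induced_iff deletion_set_def)
  then have "\<exists>k S'. claw_deletion_set (induced G X) S' \<and> card S' = k" by blast
  then have "\<exists>S'. claw_deletion_set (induced G X) S' \<and> card S' = cdn (induced G X)"
    unfolding cdn_def by (rule LeastI_ex)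
  then obtain S' where S': "deletion_set X (edges G) (\<lambda>_. 0) S'" "card S' = cdn (induced G X)"
    using assms(1,2) by (auto simp: claw_deletion_set_induced_iff)
  then show ?thesis using card_le_card_deletion_set[OF S'(1) finite stars] by simp
qed

section \<open>Rooted trees\<close>

locale rooted =
  fixes T :: "'a graph" and r :: 'a
  assumes rooted_tree: "rooted_tree T r"
begin

abbreviation E :: "'a set set" where "E \<equiv> edges T"

abbreviation descendants :: "'a \<Rightarrow> 'a set" where "descendants \<equiv> subtree_verts T r"

abbreviation children_of :: "'a \<Rightarrow> 'a set" where "children_of \<equiv> children T r"

abbreviation parent_of :: "'a \<Rightarrow> 'a option" where "parent_of \<equiv> parent T r"

lemma forest: "forest T" and simple: "simple_graph T" and finite_verts: "finite (verts T)"
  using rooted_tree by (auto simp: rooted_tree_def tree_def forest_def simple_graph_def)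

lemma edge_verts: "{u, v} \<in> E \<Longrightarrow> u \<in> verts T \<and> v \<in> verts T \<and> u \<noteq> v"
  using simple self_notin_nbrs[OF simple] by (auto simp: simple_graph_def nbrs_def)

definition root_path :: "'a \<Rightarrow> 'a list" where
  "root_path w = (THE xs. path_between T r w xs)"

lemma root_path_eq: "path_between T r w xs \<Longrightarrow> root_path w = xs"
  using forest_path_unique[OF forest] unfolding root_path_def by blast

lemma path_between_root_path: "w \<in> verts T \<Longrightarrow> path_between T r w (root_path w)"
  using rooted_tree root_path_eq by (metis connected_def rooted_tree_def tree_def)

lemma root_pathD:
  assumes "w \<in> verts T"
  shows "root_path w \<noteq> []" "distinct (root_path w)" "hd (root_path w) = r" "last (root_path w) = w"
    "set (root_path w) \<subseteq> verts T" "successively (\<lambda>x y. {x, y} \<in> E) (root_path w)"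
  using path_between_root_path[OF assms] by (auto simp: path_between_def path_def)

lemma mem_root_path: "w \<in> verts T \<Longrightarrow> w \<in> set (root_path w)"
  using root_pathD(1,4) last_in_set by metis

lemma root_path_root: "root_path r = [r]"
  using rooted_tree by (intro root_path_eq) (simp add: path_between_def path_def rooted_tree_def)

lemma ancestor_iff: "w \<in> verts T \<Longrightarrow> ancestor T r a w \<longleftrightarrow> a \<in> set (root_path w)"
  using path_between_root_path root_path_eq by (auto simp: ancestor_def)

lemma descendants_iff: "w \<in> descendants v \<longleftrightarrow> w \<in> verts T \<and> v \<in> set (root_path w)"
  by (auto simp: subtree_verts_def ancestor_iff)

lemma descendants_subset: "descendants v \<subseteq> verts T"
  by (auto simp: subtree_verts_def)

lemma self_mem_descendants: "v \<in> verts T \<Longrightarrow> v \<in> descendants v"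
  by (simp add: descendants_iff mem_root_path)

lemma root_path_prefix:
  assumes "w \<in> verts T" "a \<in> set (root_path w)"
  obtains zs where "root_path w = root_path a @ zs" "a \<notin> set zs"
proof -
  obtain ys zs where "root_path w = ys @ a # zs" "path_between T r a (ys @ [a])"
    using path_between_prefix[OF path_between_root_path[OF assms(1)] assms(2)] .
  then show ?thesis
    using that[of zs] root_path_eq[of a "ys @ [a]"] root_pathD(2)[OF assms(1)] by auto
qed

lemma root_path_snoc:
  assumes "{w, x} \<in> E" "x \<notin> set (root_path w)"
  shows "root_path x = root_path w @ [x]"
proof -
  have "w \<in> verts T" "x \<in> verts T" using edge_verts assms(1) by auto
  then have "path_between T r x (root_path w @ [x])"
    using root_pathD[of w] assms by (auto simp: path_between_def path_def successively_append_iff)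
  then show ?thesis by (rule root_path_eq)
qed

lemma root_path_edge:
  assumes "{w, x} \<in> E"
  shows "root_path x = root_path w @ [x] \<or> root_path w = root_path x @ [w]"
proof (cases "x \<in> set (root_path w)")
  case True
  have verts: "w \<in> verts T" "x \<in> verts T" "w \<noteq> x" using edge_verts assms by auto
  obtain zs where zs: "root_path w = root_path x @ zs" using root_path_prefix verts True by blast
  then have "zs \<noteq> []" using verts root_pathD(4) by (metis append_Nil2)
  then have "w \<in> set zs" using zs verts root_pathD(4) by (metis last_appendR last_in_set)
  then have "w \<notin> set (root_path x)" using root_pathD(2)[OF verts(1)] zs by auto
  then show ?thesis using root_path_snoc[of x w] assms by (simp add: insert_commute)
qed (simp add: root_path_snoc assms)

lemma children_iff:
  "u \<in> children_of v \<longleftrightarrow> {v, u} \<in> E \<and> root_path u = root_path v @ [u]"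
proof
  assume "u \<in> children_of v"
  then have below: "{v, u} \<in> E" "u \<in> verts T" "v \<in> set (root_path u)"
    by (auto simp: children_def ancestor_iff)
  then have "root_path v \<noteq> root_path u @ [v]" using edge_verts root_pathD(2)[of v] by auto
  then show "{v, u} \<in> E \<and> root_path u = root_path v @ [u]" using root_path_edge below by auto
next
  assume edge: "{v, u} \<in> E \<and> root_path u = root_path v @ [u]"
  then have "v \<in> verts T" "u \<in> verts T" using edge_verts by auto
  then show "u \<in> children_of v" using edge mem_root_path[of v]
    by (auto simp: children_def ancestor_iff)
qed

lemma child_verts: "u \<in> children_of v \<Longrightarrow> u \<in> verts T \<and> v \<in> verts T \<and> u \<noteq> v"
  using edge_verts by (auto simp: children_iff)

lemma finite_children: "finite (children_of v)"
  using finite_verts by (simp add: children_def)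

lemma parent_of_child:
  assumes "u \<in> children_of v"
  shows "parent_of u = Some v"
proof -
  have "u \<noteq> r"
    using assms child_verts[OF assms] root_pathD(1)[of v]
    by (auto simp: children_iff root_path_root)
  moreover have "v' = v" if "u \<in> children_of v'" for v'
    using that assms child_verts by (metis append1_eq_conv children_iff root_pathD(4))
  then have "(THE w. u \<in> children_of w) = v" using assms by blast
  ultimately show ?thesis by (simp add: parent_def)
qed

lemma parent_of_eq_Some_iff:
  assumes "v \<in> verts T"
  shows "parent_of v = Some p \<longleftrightarrow> v \<in> children_of p"
proof
  assume p: "parent_of v = Some p"
  then have "v \<noteq> r" by (auto simp: parent_def split: if_splits)
  note path = root_pathD[OF assms]
  obtain ys where ys: "root_path v = ys @ [v]" using path(1,4) by (metis append_butlast_last_id)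
  then have "ys \<noteq> []" using path(3) \<open>v \<noteq> r\<close> by auto
  moreover have "successively (\<lambda>x y. {x, y} \<in> E) (ys @ [v])" using path(6) ys by simp
  ultimately have edges: "successively (\<lambda>x y. {x, y} \<in> E) ys" "{last ys, v} \<in> E"
    unfolding successively_append_iff by auto
  then have "path_between T r (last ys) ys"
    using path ys \<open>ys \<noteq> []\<close> by (auto simp: path_between_def path_def hd_append)
  then have "v \<in> children_of (last ys)" using ys edges by (simp add: children_iff root_path_eq)
  moreover from parent_of_child[OF this] have "p = last ys" using p by simp
  ultimately show "v \<in> children_of p" by simp
qed (rule parent_of_child)

lemma nbrs_eq:
  assumes "v \<in> verts T"
  shows "nbrs E v = children_of v \<union> set_option (parent_of v)"
proof -
  have "{v, u} \<in> E \<longleftrightarrow> u \<in> children_of v \<or> v \<in> children_of u" for u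
    using root_path_edge[of v u] by (auto simp: children_iff insert_commute)
  then show ?thesis using parent_of_eq_Some_iff[OF assms] by (auto simp: nbrs_def)
qed

lemma proper_descendants_subset:
  assumes "x \<in> descendants v" "x \<noteq> v"
  shows "descendants x \<subseteq> descendants v - {v}"
proof
  have x: "x \<in> verts T" "v \<in> set (root_path x)" using assms(1) by (auto simp: descendants_iff)
  fix w assume "w \<in> descendants x"
  then have w: "w \<in> verts T" "x \<in> set (root_path w)" by (auto simp: descendants_iff)
  obtain zs where zs: "root_path w = root_path x @ zs" using root_path_prefix[OF w] .
  then have "w \<in> descendants v" using w x(2) by (simp add: descendants_iff)
  moreover have "w \<noteq> v"
  proof
    assume "w = v"
    then obtain us where "root_path x = root_path w @ us" using root_path_prefix x by blast
    then have "root_path x = root_path w" using zs by simp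
    then show False using root_pathD(4) x(1) w(1) assms(2) \<open>w = v\<close> by metis
  qed
  ultimately show "w \<in> descendants v - {v}" by simp
qed

lemma children_subset_descendants: "children_of v \<subseteq> descendants v"
  by (auto simp: children_def subtree_verts_def)

lemma descendants_child_subset: "u \<in> children_of v \<Longrightarrow> descendants u \<subseteq> descendants v - {v}"
  using proper_descendants_subset[of u v] children_subset_descendants child_verts by blast

lemma descendants_eq:
  assumes "v \<in> verts T"
  shows "descendants v = insert v (\<Union>u\<in>children_of v. descendants u)"
proof
  show "insert v (\<Union>u\<in>children_of v. descendants u) \<subseteq> descendants v"
    using descendants_child_subset self_mem_descendants[OF assms] by blast
  show "descendants v \<subseteq> insert v (\<Union>u\<in>children_of v. descendants u)"
  proof
    fix w assume "w \<in> descendants v"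
    then have w: "w \<in> verts T" "v \<in> set (root_path w)" by (auto simp: descendants_iff)
    obtain zs where zs: "root_path w = root_path v @ zs" using root_path_prefix[OF w] .
    show "w \<in> insert v (\<Union>u\<in>children_of v. descendants u)"
    proof (cases zs)
      case Nil
      then have "w = v" using zs root_pathD(4) w(1) assms by (metis append_Nil2)
      then show ?thesis by simp
    next
      case (Cons u us)
      have "successively (\<lambda>x y. {x, y} \<in> E) (root_path v @ u # us)"
        using root_pathD(6)[OF w(1)] zs Cons by simp
      then have "{v, u} \<in> E" using root_pathD(1,4)[OF assms] by (simp add: successively_append_iff)
      moreover have "u \<notin> set (root_path v)" using root_pathD(2)[OF w(1)] zs Cons by auto
      ultimately have "u \<in> children_of v" using root_path_snoc by (simp add: children_iff)
      moreover have "w \<in> descendants u" using w zs Cons by (simp add: descendants_iff)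
      ultimately show ?thesis by auto
    qed
  qed
qed

lemma parent_notin_descendants:
  assumes "v \<in> verts T" "parent_of v = Some p"
  shows "p \<notin> descendants v"
  using assms descendants_child_subset[of v p] by (auto simp: parent_of_eq_Some_iff)

lemma nbrs_Int_descendants:
  assumes "x \<notin> descendants v"
  shows "nbrs E x \<inter> descendants v \<subseteq> {v}"
proof
  fix w assume w: "w \<in> nbrs E x \<inter> descendants v"
  then have edge: "{w, x} \<in> E" by (simp add: nbrs_def insert_commute)
  then have v: "v \<in> set (root_path w)" "v \<notin> set (root_path x)"
    using assms w edge_verts by (auto simp: descendants_iff)
  then have "root_path w = root_path x @ [w]" using root_path_edge[OF edge] by auto
  then show "w \<in> {v}" using v by auto
qed

section \<open>The procedure\<close>

lemma claw_deletion_set_proc_unfold: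
  assumes "v \<in> verts T"
  defines "U \<equiv> (\<Union>u\<in>children_of v. claw_deletion_set_proc T r u (Some v))"
  defines "c \<equiv> card (children_of v - U)"
  shows "claw_deletion_set_proc T r v p =
    (if 3 \<le> c then insert v U
     else if c = 2 \<and> p \<noteq> None \<and> v \<notin> U then insert (the p) U else U)"
  unfolding U_def c_def using assms(1) rooted_tree
  by (subst claw_deletion_set_proc.simps) (auto simp: Let_def)

definition deleted :: "'a set" where
  "deleted = {v \<in> verts T. v \<in> claw_deletion_set_proc T r v None}"

definition deletes_parent :: "'a \<Rightarrow> bool" where
  "deletes_parent v \<longleftrightarrow> v \<notin> deleted \<and> card (children_of v - deleted) = 2"

lemma claw_deletion_set_proc_step:
  assumes v: "v \<in> verts T"
    and children: "\<And>u. u \<in> children_of v \<Longrightarrow> claw_deletion_set_proc T r u (Some v) =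
      deleted \<inter> descendants u \<union> (if deletes_parent u then {v} else {})"
  shows "v \<in> deleted \<longleftrightarrow>
      3 \<le> card (children_of v - deleted) \<or> (\<exists>u\<in>children_of v. deletes_parent u)"
    and "claw_deletion_set_proc T r v p =
      deleted \<inter> descendants v \<union> (if deletes_parent v then set_option p else {})"
proof -
  define U where "U = (\<Union>u\<in>children_of v. claw_deletion_set_proc T r u (Some v))"
  define c where "c = card (children_of v - deleted)"
  have v_notin: "v \<notin> descendants u" if "u \<in> children_of v" for u
    using descendants_child_subset[OF that] by auto
  have U: "x \<in> U \<longleftrightarrow> x \<in> deleted \<inter> (\<Union>u\<in>children_of v. descendants u)" if "x \<noteq> v" for x
    using that by (auto simp: U_def children)
  have v_U: "v \<in> U \<longleftrightarrow> (\<exists>u\<in>children_of v. deletes_parent u)"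
    using v_notin by (auto simp: U_def children split: if_splits)
  have "u \<in> U \<longleftrightarrow> u \<in> deleted" if "u \<in> children_of v" for u
    using U[of u] that child_verts[OF that] self_mem_descendants by blast
  then have "children_of v - U = children_of v - deleted" by auto
  then have proc: "claw_deletion_set_proc T r v p = (if 3 \<le> c then insert v U
      else if c = 2 \<and> p \<noteq> None \<and> v \<notin> U then insert (the p) U else U)" for p
    using claw_deletion_set_proc_unfold[OF v, of p] unfolding U_def[symmetric] c_def by simp
  have v_deleted: "v \<in> deleted \<longleftrightarrow> 3 \<le> c \<or> v \<in> U" using v by (simp add: deleted_def proc)
  then show "v \<in> deleted \<longleftrightarrow>
      3 \<le> card (children_of v - deleted) \<or> (\<exists>u\<in>children_of v. deletes_parent u)"
    by (simp add: v_U c_def)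
  have "deleted \<inter> descendants v = (if 3 \<le> c then insert v U else U)"
  proof (rule set_eqI)
    fix x
    show "x \<in> deleted \<inter> descendants v \<longleftrightarrow> x \<in> (if 3 \<le> c then insert v U else U)"
      using U[of x] v_deleted by (cases "x = v") (simp_all add: descendants_eq[OF v])
  qed
  moreover have "deletes_parent v \<longleftrightarrow> v \<notin> U \<and> c = 2"
    by (auto simp: deletes_parent_def v_deleted c_def)
  ultimately show "claw_deletion_set_proc T r v p =
      deleted \<inter> descendants v \<union> (if deletes_parent v then set_option p else {})"
    by (cases p) (auto simp: proc)
qed

lemma claw_deletion_set_proc_eq:
  "v \<in> verts T \<Longrightarrow> claw_deletion_set_proc T r v p =
     deleted \<inter> descendants v \<union> (if deletes_parent v then set_option p else {})"
proof (induction "card (descendants v)" arbitrary: v p rule: less_induct)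
  case less
  show ?case
  proof (rule claw_deletion_set_proc_step(2)[OF less.prems])
    fix u assume u: "u \<in> children_of v"
    have "descendants u \<subset> descendants v"
      by (rule child_subtree_verts_psubset[OF rooted_tree u less.prems])
    then have "card (descendants u) < card (descendants v)"
      using finite_subset[OF descendants_subset finite_verts] by (rule psubset_card_mono[rotated])
    then show "claw_deletion_set_proc T r u (Some v) =
        deleted \<inter> descendants u \<union> (if deletes_parent u then {v} else {})"
      using less.hyps[of u "Some v"] child_verts[OF u] by simp
  qed
qed

lemma deleted_iff:
  assumes "v \<in> verts T"
  shows "v \<in> deleted \<longleftrightarrow>
    3 \<le> card (children_of v - deleted) \<or> (\<exists>u\<in>children_of v. deletes_parent u)"
  by (rule claw_deletion_set_proc_step(1)[OF assms])
    (simp add: claw_deletion_set_proc_eq child_verts)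

text \<open>The nearest deleted ancestor of \<open>z\<close>, provided that it is at most two levels above \<open>z\<close>; junk
  otherwise.\<close>

definition owner :: "'a \<Rightarrow> 'a" where
  "owner z = (if z \<in> deleted then z
     else let p = the (parent_of z) in if p \<in> deleted then p else the (parent_of p))"

lemma owner_deleted: "z \<in> deleted \<Longrightarrow> owner z = z"
  by (simp add: owner_def)

lemma owner_child: "z \<notin> deleted \<Longrightarrow> z \<in> children_of p \<Longrightarrow> p \<in> deleted \<Longrightarrow> owner z = p"
  by (simp add: owner_def parent_of_child)

lemma owner_grandchild:
  "z \<notin> deleted \<Longrightarrow> z \<in> children_of y \<Longrightarrow> y \<notin> deleted \<Longrightarrow> y \<in> children_of p \<Longrightarrow> owner z = p"
  by (simp add: owner_def parent_of_child)

lemma deletes_parent_star: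
  assumes "deletes_parent v" "v \<in> children_of p"
  shows "\<exists>Q\<subseteq>insert p (descendants v). star E Q \<and> owner ` Q \<subseteq> {p}"
proof -
  let ?A = "insert p (children_of v - deleted)"
  have v: "v \<notin> deleted" "card (children_of v - deleted) = 2"
    using assms(1) by (auto simp: deletes_parent_def)
  have verts: "v \<in> verts T" "p \<in> verts T" using child_verts assms(2) by auto
  then have p: "p \<in> deleted" using deleted_iff assms by blast
  have "p \<notin> children_of v"
    using descendants_child_subset[OF assms(2)] children_subset_descendants verts
      self_mem_descendants by blast
  then have "card ?A = 3" using v(2) finite_children by simp
  moreover have "?A \<subseteq> nbrs E v" using nbrs_eq[OF verts(1)] parent_of_child[OF assms(2)] by auto
  ultimately have "star E (insert v ?A)" unfolding star_def by blast
  moreover have "insert v ?A \<subseteq> insert p (descendants v)"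
    using children_subset_descendants self_mem_descendants[OF verts(1)] by auto
  moreover have "owner ` insert v ?A \<subseteq> {p}"
    using owner_deleted[OF p] owner_child[OF v(1) assms(2) p] owner_grandchild[OF _ _ v(1) assms(2)]
    by auto
  ultimately show ?thesis by blast
qed

lemma deleted_star:
  assumes "x \<in> deleted"
  shows "\<exists>Q\<subseteq>descendants x. star E Q \<and> owner ` Q \<subseteq> {x}"
proof (cases "\<exists>u\<in>children_of x. deletes_parent u")
  case True
  then obtain u where u: "u \<in> children_of x" "deletes_parent u" by blast
  then have "insert x (descendants u) \<subseteq> descendants x"
    using descendants_child_subset self_mem_descendants child_verts by blast
  then show ?thesis using deletes_parent_star[OF u(2,1)] by (meson subset_trans)
next
  case False
  have x: "x \<in> verts T" using assms by (simp add: deleted_def)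
  then have "3 \<le> card (children_of x - deleted)" using deleted_iff assms False by blast
  then obtain A where A: "A \<subseteq> children_of x - deleted" "card A = 3"
    by (meson obtain_subset_with_card_n)
  have "A \<subseteq> nbrs E x" using A(1) nbrs_eq[OF x] by auto
  then have "star E (insert x A)" using A(2) unfolding star_def by blast
  moreover have "insert x A \<subseteq> descendants x"
    using A(1) children_subset_descendants self_mem_descendants[OF x] by blast
  moreover have "owner ` insert x A \<subseteq> {x}"
    using owner_deleted[OF assms] owner_child[OF _ _ assms] A(1) by auto
  ultimately show ?thesis by blast
qed

abbreviation descendants_plus :: "'a \<Rightarrow> 'a set" where
  "descendants_plus v \<equiv> descendants v \<union> set_option (parent_of v)"

definition greedy :: "'a \<Rightarrow> 'a set" where
  "greedy v = deleted \<inter> descendants v \<union> (if deletes_parent v then set_option (parent_of v) else {})"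

lemma descendants_plus_subset: "v \<in> verts T \<Longrightarrow> descendants_plus v \<subseteq> verts T"
  using descendants_subset child_verts parent_of_eq_Some_iff by auto

lemma kept_nbrs_le_2:
  assumes "w \<in> verts T" "w \<notin> deleted" "S \<inter> children_of w = deleted \<inter> children_of w"
    and "deletes_parent w \<Longrightarrow> set_option (parent_of w) \<subseteq> S"
  shows "card (nbrs E w - S) \<le> 2"
proof (cases "deletes_parent w")
  case True
  then have "nbrs E w - S \<subseteq> children_of w - deleted" using nbrs_eq[OF assms(1)] assms(3,4) by blast
  then have "card (nbrs E w - S) \<le> card (children_of w - deleted)"
    using finite_children by (intro card_mono) auto
  then show ?thesis using True by (simp add: deletes_parent_def)
next
  case False
  have "nbrs E w - S \<subseteq> (children_of w - deleted) \<union> set_option (parent_of w)"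
    using nbrs_eq[OF assms(1)] assms(3) by blast
  then have "card (nbrs E w - S) \<le> card ((children_of w - deleted) \<union> set_option (parent_of w))"
    using finite_children by (intro card_mono) auto
  also have "\<dots> \<le> card (children_of w - deleted) + card (set_option (parent_of w))"
    by (rule card_Un_le)
  also have "\<dots> \<le> card (children_of w - deleted) + 1" by (cases "parent_of w") auto
  also have "card (children_of w - deleted) \<le> 1"
    using False assms(1,2) deleted_iff[of w] by (auto simp: deletes_parent_def)
  finally show ?thesis by simp
qed

lemma deletion_set_greedy:
  assumes v: "v \<in> verts T"
  shows "deletion_set (descendants_plus v) E (\<lambda>_. 0) (greedy v)"
  unfolding deletion_set_def
proof (intro conjI ballI)
  let ?X = "descendants_plus v"
  show "greedy v \<subseteq> ?X" by (auto simp: greedy_def)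
  fix w assume w: "w \<in> ?X - greedy v"
  have finite: "finite (nbrs E w)" by (rule finite_nbrs[OF simple])
  show "0 + card (nbrs E w \<inter> ?X - greedy v) \<le> 2"
  proof (cases "w \<in> descendants v")
    case True
    then have "w \<in> verts T" "w \<notin> deleted" using descendants_subset w by (auto simp: greedy_def)
    moreover have "children_of w \<subseteq> descendants v"
      using True children_subset_descendants proper_descendants_subset by blast
    then have "greedy v \<inter> children_of w = deleted \<inter> children_of w"
      using parent_notin_descendants[OF v] by (auto simp: greedy_def)
    moreover have "set_option (parent_of w) \<subseteq> greedy v" if "deletes_parent w"
    proof
      fix p assume p: "p \<in> set_option (parent_of w)"
      then have child: "w \<in> children_of p" using \<open>w \<in> verts T\<close> parent_of_eq_Some_iff by simp
      then have "p \<in> deleted" using deleted_iff child_verts that by blast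
      moreover have "w \<in> nbrs E p" using child by (simp add: children_iff nbrs_def)
      then have "p \<in> descendants v" if "w \<noteq> v" using nbrs_Int_descendants[of p v] True that by auto
      ultimately show "p \<in> greedy v" using p that by (auto simp: greedy_def)
    qed
    ultimately have "card (nbrs E w - greedy v) \<le> 2" by (rule kept_nbrs_le_2)
    moreover have "card (nbrs E w \<inter> ?X - greedy v) \<le> card (nbrs E w - greedy v)"
      using finite by (intro card_mono) auto
    ultimately show ?thesis by simp
  next
    case False
    then have "?X = insert w (descendants v)" using w by auto
    then have "nbrs E w \<inter> ?X \<subseteq> {v}"
      using nbrs_Int_descendants[OF False] self_notin_nbrs[OF simple, of w] by auto
    then have "card (nbrs E w \<inter> ?X - greedy v) \<le> card {v}" by (intro card_mono) auto
    then show ?thesis by simp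
  qed
qed

lemma greedy_star:
  assumes "v \<in> verts T" "x \<in> greedy v"
  shows "\<exists>Q\<subseteq>descendants_plus v. star E Q \<and> owner ` Q \<subseteq> {x}"
proof (cases "x \<in> deleted \<inter> descendants v")
  case True
  then have "descendants x \<subseteq> descendants_plus v" using proper_descendants_subset[of x v] by blast
  then show ?thesis using deleted_star[of x] True by (meson IntD1 subset_trans)
next
  case False
  then have "deletes_parent v" and parent: "parent_of v = Some x"
    using assms(2) by (auto simp: greedy_def split: if_splits)
  then have "\<exists>Q\<subseteq>insert x (descendants v). star E Q \<and> owner ` Q \<subseteq> {x}"
    using parent_of_eq_Some_iff[OF assms(1)] by (intro deletes_parent_star) simp_all
  then show ?thesis by (simp add: parent)
qed

lemma card_greedy_le_cdn:
  assumes "X \<subseteq> verts T" "\<And>x. x \<in> greedy v \<Longrightarrow> x \<in> deleted \<and> descendants x \<subseteq> X"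
  shows "card (greedy v) \<le> cdn (induced T X)"
proof (rule card_le_cdn_induced[OF forest assms(1)])
  fix x assume "x \<in> greedy v"
  then have "x \<in> deleted" "descendants x \<subseteq> X" using assms(2) by auto
  then show "\<exists>Q\<subseteq>X. star E Q \<and> owner ` Q \<subseteq> {x}" using deleted_star by (meson subset_trans)
qed

lemma card_greedy:
  assumes "v \<in> verts T"
  shows "card (greedy v) = cdn (induced T (descendants_plus v))"
proof (rule antisym)
  note subset = descendants_plus_subset[OF assms]
  show "card (greedy v) \<le> cdn (induced T (descendants_plus v))"
    by (rule card_le_cdn_induced[OF forest subset greedy_star[OF assms]])
  show "cdn (induced T (descendants_plus v)) \<le> card (greedy v)"
    by (rule cdn_induced_le[OF forest subset deletion_set_greedy[OF assms]])
qed

lemma cdn_descendants_le: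
  assumes "v \<in> verts T"
  shows "cdn (induced T (descendants v)) \<le> card (greedy v \<inter> descendants v)"
  using deletion_set_Int[OF deletion_set_greedy[OF assms], of "descendants v"]
    finite_subset[OF descendants_plus_subset[OF assms] finite_verts]
  by (intro cdn_induced_le[OF forest descendants_subset]) auto

lemma parent_in_greedy:
  assumes "v \<in> verts T"
    and "cdn (induced T (descendants_plus v)) = 1 + cdn (induced T (descendants v))"
  shows "parent_of v \<in> Some ` greedy v"
proof (rule ccontr)
  assume "parent_of v \<notin> Some ` greedy v"
  then have "greedy v \<subseteq> deleted \<inter> descendants v"
    by (cases "parent_of v") (auto simp: greedy_def split: if_splits)
  then have "x \<in> deleted \<and> descendants x \<subseteq> descendants v" if "x \<in> greedy v" for x
    using that proper_descendants_subset[of x v] by blast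
  then have "card (greedy v) \<le> cdn (induced T (descendants v))"
    by (rule card_greedy_le_cdn[OF descendants_subset])
  then show False using card_greedy[OF assms(1)] assms(2) by simp
qed

lemma self_in_greedy:
  assumes v: "v \<in> verts T"
    and plus: "cdn (induced T (descendants_plus v)) = cdn (induced T (descendants v))"
    and "cdn (induced T (descendants v)) = 1 + cdn (induced T (descendants v - {v}))"
  shows "v \<in> greedy v"
proof (rule ccontr)
  assume "v \<notin> greedy v"
  have finite: "finite (greedy v)"
    using deletion_set_greedy[OF v] finite_subset[OF descendants_plus_subset[OF v] finite_verts]
    by (auto simp: deletion_set_def intro: finite_subset)
  have "card (greedy v) \<le> card (greedy v \<inter> descendants v)"
    using cdn_descendants_le[OF v] card_greedy[OF v] plus by simp
  then have "greedy v \<inter> descendants v = greedy v" using finite by (intro card_seteq) auto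
  then have "greedy v \<subseteq> deleted \<inter> descendants v"
    using parent_notin_descendants[OF v] by (auto simp: greedy_def split: if_splits)
  then have "x \<in> deleted \<and> descendants x \<subseteq> descendants v - {v}" if "x \<in> greedy v" for x
    using that \<open>v \<notin> greedy v\<close> proper_descendants_subset[of x v] by blast
  then have "card (greedy v) \<le> cdn (induced T (descendants v - {v}))"
    using descendants_subset by (intro card_greedy_le_cdn) auto
  then show False using card_greedy[OF v] assms(2,3) by simp
qed

lemma claw_deletion_set_proc_parent:
  "v \<in> verts T \<Longrightarrow> claw_deletion_set_proc T r v (parent_of v) = greedy v"
  by (simp add: claw_deletion_set_proc_eq greedy_def)

end

lemma claw_deletion_set_proc_correct:
  assumes "rooted_tree T r" "v \<in> verts T"
  defines "S \<equiv> claw_deletion_set_proc T r v (parent T r v)"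
  shows "min_claw_deletion_set (subtree_plus T r v) S"
    and "cdn (subtree_plus T r v) = 1 + cdn (subtree T r v) \<Longrightarrow> parent T r v \<in> Some ` S"
    and "cdn (subtree_plus T r v) = cdn (subtree T r v) \<Longrightarrow>
      cdn (subtree T r v) = 1 + cdn (delete_verts (subtree T r v) {v}) \<Longrightarrow> v \<in> S"
proof -
  interpret rooted T r by unfold_locales fact
  have S: "S = greedy v" unfolding S_def by (rule claw_deletion_set_proc_parent) fact
  have delete: "delete_verts (subtree T r v) {v} = induced T (descendants v - {v})"
    by (simp add: subtree_def delete_verts_induced descendants_subset)
  show "min_claw_deletion_set (subtree_plus T r v) S"
    using deletion_set_greedy[OF assms(2)] card_greedy[OF assms(2)]
    by (simp add: S min_claw_deletion_set_def subtree_plus_def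
        claw_deletion_set_induced_iff[OF forest descendants_plus_subset[OF assms(2)]])
  show "cdn (subtree_plus T r v) = 1 + cdn (subtree T r v) \<Longrightarrow> parent T r v \<in> Some ` S"
    using parent_in_greedy[OF assms(2)] by (simp add: S subtree_plus_def subtree_def)
  show "cdn (subtree_plus T r v) = cdn (subtree T r v) \<Longrightarrow>
      cdn (subtree T r v) = 1 + cdn (delete_verts (subtree T r v) {v}) \<Longrightarrow> v \<in> S"
    using self_in_greedy[OF assms(2)] unfolding delete by (simp add: S subtree_plus_def subtree_def)
qed

section \<open>Peeling leaves\<close>

definition has_deletion_set :: "'a set \<Rightarrow> 'a set set \<Rightarrow> ('a \<Rightarrow> nat) \<Rightarrow> nat \<Rightarrow> bool" where
  "has_deletion_set V E w k \<longleftrightarrow> (\<exists>S. deletion_set V E w S \<and> card S \<le> k)"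

definition leaf_weight :: "nat \<Rightarrow> nat" where
  "leaf_weight c = (if 3 \<le> c then 0 else if c = 2 then 3 else 1)"

definition peel_weight :: "'a \<Rightarrow> 'a \<Rightarrow> ('a \<Rightarrow> nat) \<Rightarrow> 'a \<Rightarrow> nat" where
  "peel_weight v p w = w(p := w p + leaf_weight (w v))"

lemma nbrs_remove_edge:
  "nbrs (E - {{v, p}}) v = nbrs E v - {p}"
  "nbrs (E - {{v, p}}) p = nbrs E p - {v}"
  "x \<noteq> v \<Longrightarrow> x \<noteq> p \<Longrightarrow> nbrs (E - {{v, p}}) x = nbrs E x"
  by (auto simp: nbrs_def doubleton_eq_iff)

locale leaf =
  fixes V :: "'a set" and E :: "'a set set" and v p :: 'a
  assumes finite: "finite V" and verts: "v \<in> V" "p \<in> V" "v \<noteq> p" and nbrs_leaf: "nbrs E v = {p}"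
begin

abbreviation peeled :: "'a set set" where "peeled \<equiv> E - {{v, p}}"

definition others_kept :: "('a \<Rightarrow> nat) \<Rightarrow> 'a set \<Rightarrow> bool" where
  "others_kept w S \<longleftrightarrow> (\<forall>x\<in>V - S - {v, p}. w x + card (nbrs E x \<inter> V - S) \<le> 2)"

lemma deletion_set_split:
  "deletion_set V E' w S \<longleftrightarrow> S \<subseteq> V \<and>
     (v \<notin> S \<longrightarrow> w v + card (nbrs E' v \<inter> V - S) \<le> 2) \<and>
     (p \<notin> S \<longrightarrow> w p + card (nbrs E' p \<inter> V - S) \<le> 2) \<and>
     (\<forall>x\<in>V - S - {v, p}. w x + card (nbrs E' x \<inter> V - S) \<le> 2)"
  using verts by (auto simp: deletion_set_def)

lemma deletion_set_iff:
  "deletion_set V E w S \<longleftrightarrow> S \<subseteq> V \<and> (v \<notin> S \<longrightarrow> w v + (if p \<in> S then 0 else 1) \<le> 2) \<and>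
     (p \<notin> S \<longrightarrow> w p + card (nbrs peeled p \<inter> V - S) + (if v \<in> S then 0 else 1) \<le> 2) \<and>
     others_kept w S"
proof -
  have "nbrs E v \<inter> V - S = (if p \<in> S then {} else {p})" using nbrs_leaf verts by auto
  then have "card (nbrs E v \<inter> V - S) = (if p \<in> S then 0 else 1)" by simp
  moreover have "nbrs E p \<inter> V - S =
      (if v \<in> S then nbrs peeled p \<inter> V - S else insert v (nbrs peeled p \<inter> V - S))"
    using nbrs_leaf mem_nbrs_commute[of v E p] verts by (auto simp: nbrs_remove_edge)
  then have "card (nbrs E p \<inter> V - S) = card (nbrs peeled p \<inter> V - S) + (if v \<in> S then 0 else 1)"
    using finite by (simp add: nbrs_remove_edge)
  ultimately show ?thesis by (simp add: deletion_set_split others_kept_def add.assoc)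
qed

lemma deletion_set_peeled_iff:
  "deletion_set V peeled (peel_weight v p w) S \<longleftrightarrow> S \<subseteq> V \<and> (v \<notin> S \<longrightarrow> w v \<le> 2) \<and>
     (p \<notin> S \<longrightarrow> w p + leaf_weight (w v) + card (nbrs peeled p \<inter> V - S) \<le> 2) \<and>
     others_kept w S"
  using verts nbrs_leaf
  by (auto simp: deletion_set_split others_kept_def peel_weight_def nbrs_remove_edge)

lemma deletion_set_if_peeled:
  "deletion_set V peeled (peel_weight v p w) S \<Longrightarrow> deletion_set V E w S"
  unfolding deletion_set_iff deletion_set_peeled_iff
  by (auto simp: leaf_weight_def split: if_splits)

lemma deletion_set_peeled:
  assumes "deletion_set V E w S" "v \<in> S \<Longrightarrow> p \<in> S \<or> 3 \<le> w v"
  shows "deletion_set V peeled (peel_weight v p w) S"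
  using assms unfolding deletion_set_iff deletion_set_peeled_iff
  by (auto simp: leaf_weight_def split: if_splits)

lemma deletion_set_swap:
  assumes "deletion_set V E w S" "w v \<le> 2"
  shows "deletion_set V E w (insert p (S - {v}))"
proof -
  let ?S = "insert p (S - {v})"
  have "others_kept w ?S" unfolding others_kept_def
  proof
    fix x assume x: "x \<in> V - ?S - {v, p}"
    then have "v \<notin> nbrs E x" using nbrs_leaf mem_nbrs_commute[of v E x] by simp
    then have "card (nbrs E x \<inter> V - ?S) \<le> card (nbrs E x \<inter> V - S)"
      using finite by (intro card_mono) auto
    moreover have "w x + card (nbrs E x \<inter> V - S) \<le> 2"
      using assms(1) x by (auto simp: deletion_set_def)
    ultimately show "w x + card (nbrs E x \<inter> V - ?S) \<le> 2" by simp
  qed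
  then show ?thesis using assms verts by (auto simp: deletion_set_iff)
qed

lemma has_deletion_set_peel:
  "has_deletion_set V peeled (peel_weight v p w) k \<longleftrightarrow> has_deletion_set V E w k"
proof
  show "has_deletion_set V peeled (peel_weight v p w) k \<Longrightarrow> has_deletion_set V E w k"
    unfolding has_deletion_set_def using deletion_set_if_peeled by blast
next
  assume "has_deletion_set V E w k"
  then obtain S where S: "deletion_set V E w S" "card S \<le> k" by (auto simp: has_deletion_set_def)
  show "has_deletion_set V peeled (peel_weight v p w) k"
  proof (cases "v \<in> S \<and> p \<notin> S \<and> w v \<le> 2")
    case True
    let ?S = "insert p (S - {v})"
    have "finite S" using S(1) finite finite_subset by (auto simp: deletion_set_def)
    then have "card ?S = card S" using True card_Suc_Diff1[of S v] by simp
    moreover have "deletion_set V peeled (peel_weight v p w) ?S"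
      using True deletion_set_swap[OF S(1)] by (intro deletion_set_peeled) auto
    ultimately show ?thesis using S(2) unfolding has_deletion_set_def by metis
  next
    case False
    then have "deletion_set V peeled (peel_weight v p w) S"
      using S(1) by (intro deletion_set_peeled) auto
    then show ?thesis using S(2) unfolding has_deletion_set_def by blast
  qed
qed

end

lemma has_deletion_set_edgeless:
  assumes "finite V"
  shows "has_deletion_set V {} w k \<longleftrightarrow> card {v \<in> V. 3 \<le> w v} \<le> k"
proof -
  let ?heavy = "{v \<in> V. 3 \<le> w v}"
  have iff: "deletion_set V {} w S \<longleftrightarrow> S \<subseteq> V \<and> ?heavy \<subseteq> S" for S
  proof -
    have "deletion_set V {} w S \<longleftrightarrow> S \<subseteq> V \<and> (\<forall>v\<in>V - S. w v \<le> 2)"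
      by (simp add: deletion_set_def nbrs_def)
    moreover have "w v \<le> 2 \<longleftrightarrow> \<not> 3 \<le> w v" for v by linarith
    ultimately show ?thesis by auto
  qed
  show ?thesis
  proof
    assume "has_deletion_set V {} w k"
    then obtain S where "S \<subseteq> V" "?heavy \<subseteq> S" "card S \<le> k"
      by (auto simp: has_deletion_set_def iff)
    then show "card ?heavy \<le> k" using assms by (meson card_mono finite_subset le_trans)
  next
    assume "card ?heavy \<le> k"
    moreover have "deletion_set V {} w ?heavy" by (simp add: iff)
    ultimately show "has_deletion_set V {} w k" unfolding has_deletion_set_def by blast
  qed
qed

lemma linear_forest_deletion_yes_iff:
  assumes "forest F"
  shows "linear_forest_deletion_yes (F, k) \<longleftrightarrow>
    has_deletion_set (verts F) (edges F) (\<lambda>_. 0) k"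
proof -
  have "deletion_set (verts F) (edges F) (\<lambda>_. 0) S \<longleftrightarrow> claw_deletion_set F S" for S
    using claw_deletion_set_induced_iff[OF assms order_refl]
    by (simp add: induced_verts forest_imp_simple_graph assms)
  moreover have "linear_forest (delete_verts F S) \<longleftrightarrow> claw_free (delete_verts F S)" for S
    by (intro linear_forest_iff_claw_free forest_delete_verts assms)
  ultimately show ?thesis
    by (auto simp: linear_forest_deletion_yes_def has_deletion_set_def claw_deletion_set_def)
qed

section \<open>Running time of machine programs\<close>

fun loop_free :: "ram_prog \<Rightarrow> bool" where
  "loop_free (Seq P Q) \<longleftrightarrow> loop_free P \<and> loop_free Q"
| "loop_free (IfNz i P Q) \<longleftrightarrow> loop_free P \<and> loop_free Q"
| "loop_free (WhileNz i P) \<longleftrightarrow> False"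
| "loop_free _ \<longleftrightarrow> True"

fun run :: "ram_prog \<Rightarrow> ram_state \<Rightarrow> ram_state" where
  "run (Const i c) (R, M) = (R(i := c), M)"
| "run (Add i j k) (R, M) = (R(i := R j + R k), M)"
| "run (Sub i j k) (R, M) = (R(i := R j - R k), M)"
| "run (Load i j) (R, M) = (R(i := M (R j)), M)"
| "run (Store i j) (R, M) = (R, M(R i := R j))"
| "run (Seq P Q) s = run Q (run P s)"
| "run (IfNz i P Q) s = (if fst s i \<noteq> 0 then run P s else run Q s)"
| "run _ s = s"

fun cost :: "ram_prog \<Rightarrow> nat" where
  "cost (Seq P Q) = cost P + cost Q"
| "cost (IfNz i P Q) = 1 + max (cost P) (cost Q)"
| "cost _ = 1"

fun block :: "ram_prog list \<Rightarrow> ram_prog" where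
  "block [] = Skip"
| "block (P # Ps) = Seq P (block Ps)"

definition ends_within :: "nat \<Rightarrow> ram_prog \<Rightarrow> ram_state \<Rightarrow> (ram_state \<Rightarrow> bool) \<Rightarrow> bool" where
  "ends_within b P s Q \<longleftrightarrow> (\<exists>t s'. ram_exec P s t s' \<and> t \<le> b \<and> Q s')"

lemma ends_within_mono:
  "ends_within b P s Q \<Longrightarrow> b \<le> b' \<Longrightarrow> (\<And>s'. Q s' \<Longrightarrow> Q' s') \<Longrightarrow> ends_within b' P s Q'"
  unfolding ends_within_def using le_trans by blast

lemma ends_within_Seq:
  assumes "ends_within b P s Q" "\<And>s'. Q s' \<Longrightarrow> ends_within b' P' s' Q'"
  shows "ends_within (b + b') (Seq P P') s Q'"
proof -
  obtain t s' where P: "ram_exec P s t s'" "t \<le> b" "Q s'"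
    using assms(1) by (auto simp: ends_within_def)
  obtain t' s'' where P': "ram_exec P' s' t' s''" "t' \<le> b'" "Q' s''"
    using assms(2)[OF P(3)] by (auto simp: ends_within_def)
  have "ram_exec (Seq P P') s (t + t') s''" using P(1) P'(1) by (rule ram_exec.intros)
  then show ?thesis unfolding ends_within_def using P(2) P'(2,3) add_mono by blast
qed

lemma ends_within_IfNz:
  assumes "fst s i \<noteq> 0 \<Longrightarrow> ends_within b P s Q" "fst s i = 0 \<Longrightarrow> ends_within b P' s Q"
  shows "ends_within (1 + b) (IfNz i P P') s Q"
proof (cases "fst s i = 0")
  case True
  then obtain t s' where "ram_exec P' s t s'" "t \<le> b" "Q s'"
    using assms(2) by (auto simp: ends_within_def)
  moreover have "ram_exec (IfNz i P P') s (1 + t) s'"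
    using True \<open>ram_exec P' s t s'\<close> by (rule ram_exec.intros)
  ultimately show ?thesis unfolding ends_within_def using add_left_mono by blast
next
  case False
  then obtain t s' where "ram_exec P s t s'" "t \<le> b" "Q s'"
    using assms(1) by (auto simp: ends_within_def)
  moreover have "ram_exec (IfNz i P P') s (1 + t) s'"
    using False \<open>ram_exec P s t s'\<close> by (rule ram_exec.intros)
  ultimately show ?thesis unfolding ends_within_def using add_left_mono by blast
qed

lemma ends_within_run: "loop_free P \<Longrightarrow> ends_within (cost P) P s (\<lambda>s'. s' = run P s)"
proof (induction P arbitrary: s)
  case (Seq P Q)
  then have "ends_within (cost P) P s (\<lambda>s'. s' = run P s)" by simp
  moreover have "ends_within (cost Q) Q s' (\<lambda>s''. s'' = run (Seq P Q) s)" if "s' = run P s" for s'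
    using Seq that by simp
  ultimately show ?case unfolding cost.simps by (rule ends_within_Seq)
next
  case (IfNz i P Q)
  have "ends_within (max (cost P) (cost Q)) P s (\<lambda>s'. s' = run P s)"
    by (rule ends_within_mono[OF IfNz.IH(1)]) (use IfNz.prems in auto)
  moreover have "ends_within (max (cost P) (cost Q)) Q s (\<lambda>s'. s' = run Q s)"
    by (rule ends_within_mono[OF IfNz.IH(2)]) (use IfNz.prems in auto)
  ultimately show ?case unfolding cost.simps by (intro ends_within_IfNz) simp_all
qed (cases s; force simp: ends_within_def intro: ram_exec.intros)+

lemma ends_within_loop_free: "loop_free P \<Longrightarrow> Q (run P s) \<Longrightarrow> ends_within (cost P) P s Q"
  using ends_within_run by (rule ends_within_mono) auto

lemma ends_within_WhileNz:
  assumes "I m s"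
    and step: "\<And>m s. I m s \<Longrightarrow> fst s i \<noteq> 0 \<Longrightarrow>
      \<exists>d. 0 < d \<and> d \<le> m \<and> ends_within (c * d) P s (I (m - d))"
  shows "ends_within (Suc c * m + 1) (WhileNz i P) s (\<lambda>s'. fst s' i = 0 \<and> (\<exists>m'. I m' s'))"
  using assms(1)
proof (induction m arbitrary: s rule: less_induct)
  case (less m)
  show ?case
  proof (cases "fst s i = 0")
    case True
    then have "ram_exec (WhileNz i P) s 1 s" by (rule ram_exec.intros)
    then show ?thesis unfolding ends_within_def
      using True less.prems by (intro exI[of _ 1] exI[of _ s]) auto
  next
    case False
    obtain d where d: "0 < d" "d \<le> m" and body: "ends_within (c * d) P s (I (m - d))"
      using step[OF less.prems False] by blast
    obtain t s' where P: "ram_exec P s t s'" "t \<le> c * d" "I (m - d) s'"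
      using body by (auto simp: ends_within_def)
    have "ends_within (Suc c * (m - d) + 1) (WhileNz i P) s' (\<lambda>s'. fst s' i = 0 \<and> (\<exists>m'. I m' s'))"
      by (rule less.IH[OF _ P(3)]) (use d in simp)
    then obtain t' s'' where loop: "ram_exec (WhileNz i P) s' t' s''" "t' \<le> Suc c * (m - d) + 1"
      and post: "fst s'' i = 0" "\<exists>m'. I m' s''"
      unfolding ends_within_def by blast
    have "ram_exec (WhileNz i P) s (1 + t + t') s''"
      using False P(1) loop(1) by (rule ram_exec.intros)
    moreover have "Suc c * (m - d) + Suc c * d = Suc c * m"
      using d(2) by (metis add_mult_distrib2 le_add_diff_inverse2)
    then have "1 + t + t' \<le> Suc c * m + 1" using P(2) loop(2) d(1) by simp
    ultimately show ?thesis unfolding ends_within_def using post by blast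
  qed
qed

lemma ends_within_WhileNz_loop_free:
  assumes "loop_free P" "I m s"
    and step: "\<And>m s. I m s \<Longrightarrow> fst s i \<noteq> 0 \<Longrightarrow> 0 < m \<and> I (m - 1) (run P s)"
  shows "ends_within (Suc (cost P) * m + 1) (WhileNz i P) s (\<lambda>s'. fst s' i = 0 \<and> (\<exists>m'. I m' s'))"
proof (rule ends_within_WhileNz[where I = I, OF assms(2)])
  fix m s assume "I m s" "fst s i \<noteq> 0"
  then have "0 < m" "I (m - 1) (run P s)" using step by auto
  then show "\<exists>d. 0 < d \<and> d \<le> m \<and> ends_within (cost P * d) P s (I (m - d))"
    using ends_within_loop_free[OF assms(1), of "I (m - 1)" s] by (intro exI[of _ 1]) simp
qed

section \<open>The program\<close>

text \<open>Register \<open>i\<close> holds the constant \<open>i\<close> for \<open>i \<le> 3\<close>; register 0 receives the answer at the end.\<close>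

abbreviation (input) reg_n :: nat where "reg_n \<equiv> 4"
abbreviation (input) reg_k :: nat where "reg_k \<equiv> 5"
abbreviation (input) reg_base :: nat where "reg_base \<equiv> 6"
abbreviation (input) reg_loop :: nat where "reg_loop \<equiv> 7"
abbreviation (input) reg_pos :: nat where "reg_pos \<equiv> 8"
abbreviation (input) reg_addr :: nat where "reg_addr \<equiv> 9"
abbreviation (input) reg_leaf :: nat where "reg_leaf \<equiv> 10"
abbreviation (input) reg_nbr :: nat where "reg_nbr \<equiv> 11"
abbreviation (input) reg_sum :: nat where "reg_sum \<equiv> 12"
abbreviation (input) reg_x :: nat where "reg_x \<equiv> 13"
abbreviation (input) reg_y :: nat where "reg_y \<equiv> 14"

text \<open>Vertex \<open>v\<close> owns three memory cells: residual degree, sum of the residual neighbours, weight.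
  The neighbour of a leaf is thus read off from the second cell. The cells start at address
  \<open>3 n + 3\<close>, which is beyond the input because a forest on \<open>n\<close> vertices has at most \<open>n\<close> edges.\<close>

definition cell :: "nat \<Rightarrow> nat \<Rightarrow> nat" where
  "cell b v = b + 3 * v"

definition const_regs :: "nat \<Rightarrow> nat \<Rightarrow> nat \<Rightarrow> (nat \<Rightarrow> nat) \<Rightarrow> bool" where
  "const_regs n k b R \<longleftrightarrow> R 0 = 0 \<and> R 1 = 1 \<and> R 2 = 2 \<and> R 3 = 3 \<and>
     R reg_n = n \<and> R reg_k = k \<and> R reg_base = b"

definition read_init :: ram_prog where
  "read_init = block [Const 1 1, Const 2 2, Const 3 3, Load reg_n 0, Load reg_k 1,
     Add reg_base reg_n reg_n, Add reg_base reg_base reg_n, Add reg_base reg_base 3,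
     Const reg_pos 2, Add reg_addr reg_base 0, Add reg_loop reg_n 0]"

definition sum_body :: ram_prog where
  "sum_body = block [Load reg_y reg_pos, Add reg_sum reg_sum reg_y, Add reg_pos reg_pos 1,
     Sub reg_x reg_x 1]"

definition read_degree :: ram_prog where
  "read_degree = block [Load reg_x reg_pos, Store reg_addr reg_x, Add reg_pos reg_pos 1,
     Const reg_sum 0]"

definition store_sum :: ram_prog where
  "store_sum = block [Add reg_addr reg_addr 1, Store reg_addr reg_sum, Add reg_addr reg_addr 2,
     Sub reg_loop reg_loop 1]"

definition read_body :: ram_prog where
  "read_body = Seq read_degree (Seq (WhileNz reg_x sum_body) store_sum)"

definition read_prog :: ram_prog where
  "read_prog = Seq read_init (WhileNz reg_loop read_body)"

definition peel_init :: ram_prog where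
  "peel_init = block [Const reg_pos 0, Const reg_leaf 0, Add reg_loop reg_n 0]"

definition peel_leaf :: ram_prog where
  "peel_leaf = block [Store reg_addr 0, Add reg_addr reg_addr 1, Load reg_nbr reg_addr,
     Store reg_addr 0, Add reg_addr reg_addr 1, Load reg_y reg_addr,
     Add reg_addr reg_base reg_nbr, Add reg_addr reg_addr reg_nbr, Add reg_addr reg_addr reg_nbr,
     Load reg_x reg_addr, Sub reg_x reg_x 1, Store reg_addr reg_x,
     Add reg_addr reg_addr 1, Load reg_x reg_addr, Sub reg_x reg_x reg_leaf, Store reg_addr reg_x,
     Add reg_addr reg_addr 1, Load reg_x reg_addr, Sub reg_sum reg_y 2,
     IfNz reg_sum Skip
       (block [Sub reg_sum reg_y 1, IfNz reg_sum (Add reg_x reg_x 3) (Add reg_x reg_x 1)]),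
     Store reg_addr reg_x, Add reg_leaf reg_nbr 0]"

text \<open>With \<open>d\<close> the residual degree, \<open>d - (d - 1) - (d - 1)\<close> is nonzero only for \<open>d = 1\<close>.\<close>

definition peel_body :: ram_prog where
  "peel_body = block [Add reg_addr reg_base reg_leaf, Add reg_addr reg_addr reg_leaf,
     Add reg_addr reg_addr reg_leaf, Load reg_x reg_addr,
     Sub reg_y reg_x 1, Sub reg_x reg_x reg_y, Sub reg_x reg_x reg_y,
     IfNz reg_x peel_leaf
       (block [Add reg_pos reg_pos 1, Add reg_leaf reg_pos 0, Sub reg_loop reg_n reg_pos])]"

definition peel_prog :: ram_prog where
  "peel_prog = Seq peel_init (WhileNz reg_loop peel_body)"

definition count_init :: ram_prog where
  "count_init = block [Const reg_pos 0, Add reg_addr reg_base 2, Add reg_loop reg_n 0]"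

definition count_body :: ram_prog where
  "count_body = block [Load reg_x reg_addr, Sub reg_x reg_x 2,
     IfNz reg_x (Add reg_pos reg_pos 1) Skip, Add reg_addr reg_addr 3, Sub reg_loop reg_loop 1]"

definition answer_prog :: ram_prog where
  "answer_prog = block [Sub reg_x reg_pos reg_k, IfNz reg_x (Const 0 0) (Const 0 1)]"

definition count_prog :: ram_prog where
  "count_prog = Seq count_init (Seq (WhileNz reg_loop count_body) answer_prog)"

definition linear_forest_deletion_prog :: ram_prog where
  "linear_forest_deletion_prog = Seq read_prog (Seq peel_prog count_prog)"

lemmas block_defs = read_init_def sum_body_def read_degree_def store_sum_def peel_init_def
  peel_leaf_def peel_body_def count_init_def count_body_def answer_prog_def

lemma loop_free_blocks:
  "loop_free read_init" "loop_free sum_body" "loop_free read_degree" "loop_free store_sum"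
  "loop_free peel_init" "loop_free peel_body" "loop_free count_init" "loop_free count_body"
  "loop_free answer_prog"
  by (simp_all add: block_defs)

lemma cell_neq:
  "cell b u = cell b v \<longleftrightarrow> u = v"
  "Suc (cell b u) \<noteq> cell b v" "cell b u \<noteq> Suc (cell b v)"
  "Suc (Suc (cell b u)) \<noteq> cell b v" "cell b u \<noteq> Suc (Suc (cell b v))"
  unfolding cell_def by presburger+

lemma cell_fold: "b + v + v + v = cell b v"
  by (simp add: cell_def)

subsection \<open>Reading the input\<close>

fun stored :: "(nat \<Rightarrow> nat) \<Rightarrow> nat \<Rightarrow> nat list \<Rightarrow> bool" where
  "stored M a [] \<longleftrightarrow> True"
| "stored M a (x # xs) \<longleftrightarrow> M a = x \<and> stored M (Suc a) xs"

lemma stored_append: "stored M a (xs @ ys) \<longleftrightarrow> stored M a xs \<and> stored M (a + length xs) ys"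
  by (induction xs arbitrary: a) auto

lemma stored_fun_upd: "a + length xs \<le> i \<Longrightarrow> stored (M(i := y)) a xs \<longleftrightarrow> stored M a xs"
  by (induction xs arbitrary: a) auto

lemma stored_iff: "stored M a xs \<longleftrightarrow> (\<forall>i<length xs. M (a + i) = xs ! i)"
  by (induction xs arbitrary: a) (auto simp: less_Suc_eq_0_disj)

lemma ends_within_sum_loop:
  assumes "R 1 = 1" "R reg_x = length ys" "stored M (R reg_pos) ys"
  shows "ends_within (Suc (cost sum_body) * length ys + 1) (WhileNz reg_x sum_body) (R, M)
    (\<lambda>(R', M'). M' = M \<and> R' reg_pos = R reg_pos + length ys \<and>
       R' reg_sum = R reg_sum + sum_list ys \<and>
       (\<forall>i. i \<notin> {reg_pos, reg_sum, reg_x, reg_y} \<longrightarrow> R' i = R i))"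
proof -
  define summing where "summing m = (\<lambda>(R', M'). M' = M \<and> (\<exists>zs. R' reg_x = m \<and> length zs = m \<and>
      stored M (R' reg_pos) zs \<and> R' reg_pos + m = R reg_pos + length ys \<and>
      R' reg_sum + sum_list zs = R reg_sum + sum_list ys) \<and>
      (\<forall>i. i \<notin> {reg_pos, reg_sum, reg_x, reg_y} \<longrightarrow> R' i = R i))" for m
  have "summing (length ys) (R, M)" using assms by (auto simp: summing_def intro!: exI[of _ ys])
  moreover have "0 < m \<and> summing (m - 1) (run sum_body s)"
    if inv: "summing m s" and nonzero: "fst s reg_x \<noteq> 0" for m s
  proof -
    obtain R' M' where "s = (R', M')" by (cases s)
    then have s: "s = (R', M)" and
      frame: "\<forall>i. i \<notin> {reg_pos, reg_sum, reg_x, reg_y} \<longrightarrow> R' i = R i"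
      using inv by (auto simp: summing_def)
    obtain zs where zs: "R' reg_x = m" "length zs = m" "stored M (R' reg_pos) zs"
      "R' reg_pos + m = R reg_pos + length ys" "R' reg_sum + sum_list zs = R reg_sum + sum_list ys"
      using inv by (auto simp: summing_def s)
    moreover from this obtain z zs' where "zs = z # zs'" using nonzero by (cases zs) (auto simp: s)
    moreover have "R' 1 = 1" using frame assms(1) by simp
    ultimately show ?thesis
      using frame by (auto simp: summing_def s sum_body_def intro!: exI[of _ zs'])
  qed
  ultimately have "ends_within (Suc (cost sum_body) * length ys + 1) (WhileNz reg_x sum_body) (R, M)
      (\<lambda>s. fst s reg_x = 0 \<and> (\<exists>m. summing m s))"
    using loop_free_blocks by (intro ends_within_WhileNz_loop_free)
  then show ?thesis by (rule ends_within_mono) (auto simp: summing_def)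
qed

lemma read_body_correct:
  assumes "const_regs n k b R" "stored M (R reg_pos) (length ns # ns)"
    and "R reg_pos + Suc (length ns) \<le> R reg_addr"
  shows "ends_within (20 * Suc (length ns)) read_body (R, M)
    (\<lambda>(R', M'). const_regs n k b R' \<and> R' reg_pos = R reg_pos + Suc (length ns) \<and>
       R' reg_addr = R reg_addr + 3 \<and> R' reg_loop = R reg_loop - 1 \<and>
       M' = M(R reg_addr := length ns, Suc (R reg_addr) := sum_list ns))"
    (is "ends_within _ _ _ ?post")
proof -
  let ?M = "M(R reg_addr := length ns)"
  define R1 where "R1 = fst (run read_degree (R, M))"
  have degree: "ends_within (cost read_degree) read_degree (R, M) (\<lambda>s. s = (R1, ?M))"
    using assms by (intro ends_within_loop_free loop_free_blocks)
      (simp add: R1_def read_degree_def const_regs_def)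
  have R1: "R1 reg_pos = Suc (R reg_pos)" "R1 reg_x = length ns" "R1 reg_sum = 0"
    "const_regs n k b R1" "R1 reg_addr = R reg_addr" "R1 reg_loop = R reg_loop"
    using assms(1,2) by (simp_all add: R1_def read_degree_def const_regs_def)
  have "stored ?M (R1 reg_pos) ns" using assms(2,3) R1(1) by (simp add: stored_fun_upd)
  then have sum: "ends_within (Suc (cost sum_body) * length ns + 1)
      (WhileNz reg_x sum_body) (R1, ?M)
      (\<lambda>(R', M'). M' = ?M \<and> R' reg_pos = R1 reg_pos + length ns \<and>
         R' reg_sum = R1 reg_sum + sum_list ns \<and>
         (\<forall>i. i \<notin> {reg_pos, reg_sum, reg_x, reg_y} \<longrightarrow> R' i = R1 i))"
    using R1(2,4) by (intro ends_within_sum_loop) (simp_all add: const_regs_def)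
  have store: "ends_within (cost store_sum) store_sum (R', M') ?post"
    if "M' = ?M" "R' reg_pos = R1 reg_pos + length ns" "R' reg_sum = R1 reg_sum + sum_list ns"
      "\<forall>i. i \<notin> {reg_pos, reg_sum, reg_x, reg_y} \<longrightarrow> R' i = R1 i" for R' M'
    using that R1 by (intro ends_within_loop_free loop_free_blocks)
      (simp add: store_sum_def const_regs_def)
  have "ends_within (Suc (cost sum_body) * length ns + 1 + cost store_sum)
      (Seq (WhileNz reg_x sum_body) store_sum) (R1, ?M) ?post"
    by (rule ends_within_Seq[OF sum]) (use store in auto)
  then have "ends_within (cost read_degree + (Suc (cost sum_body) * length ns + 1 + cost store_sum))
      read_body (R, M) ?post"
    unfolding read_body_def by (intro ends_within_Seq[OF degree]) simp
  then show ?thesis by (rule ends_within_mono) (simp_all add: block_defs)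
qed

subsection \<open>Peeling and counting\<close>

definition peel_memory :: "nat \<Rightarrow> nat \<Rightarrow> nat \<Rightarrow> (nat \<Rightarrow> nat) \<Rightarrow> nat \<Rightarrow> nat" where
  "peel_memory b v p M = M(cell b v := 0, Suc (cell b v) := 0,
     cell b p := M (cell b p) - 1,
     Suc (cell b p) := M (Suc (cell b p)) - v,
     Suc (Suc (cell b p)) := M (Suc (Suc (cell b p))) + leaf_weight (M (Suc (Suc (cell b v)))))"

lemma run_peel_body_skip:
  assumes "const_regs n k b R" "M (cell b (R reg_leaf)) \<noteq> 1"
  shows "case run peel_body (R, M) of (R', M') \<Rightarrow> const_regs n k b R' \<and>
    R' reg_pos = Suc (R reg_pos) \<and> R' reg_leaf = Suc (R reg_pos) \<and>
    R' reg_loop = n - Suc (R reg_pos) \<and> M' = M"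
proof -
  define d where "d = M (cell b (R reg_leaf))"
  have "d \<le> d - Suc 0 + (d - Suc 0)" using assms(2) by (simp add: d_def)
  then show ?thesis using assms(1)
    by (simp add: peel_body_def const_regs_def cell_fold d_def[symmetric])
qed

lemma run_peel_body_leaf:
  assumes "const_regs n k b R" "R reg_leaf = v" "M (cell b v) = 1" "M (Suc (cell b v)) = p" "p \<noteq> v"
  shows "case run peel_body (R, M) of (R', M') \<Rightarrow> const_regs n k b R' \<and>
    R' reg_pos = R reg_pos \<and> R' reg_leaf = p \<and> R' reg_loop = R reg_loop \<and>
    M' = peel_memory b v p M"
proof -
  obtain c where c: "M (Suc (Suc (cell b v))) = c" by blast
  consider "3 \<le> c" | "c = 2" | "c < 2" by linarith
  then show ?thesis
    using assms c unfolding const_regs_def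
    by cases (simp_all add: peel_body_def peel_leaf_def peel_memory_def leaf_weight_def
        cell_fold cell_neq)
qed

locale forest_table =
  fixes F :: "nat graph" and n k b :: nat
  assumes forest: "forest F" and verts: "verts F = {..<n}"
begin

lemma simple: "simple_graph F"
  using forest by (rule forest_imp_simple_graph)

definition represents :: "(nat \<Rightarrow> nat) \<Rightarrow> nat set set \<Rightarrow> (nat \<Rightarrow> nat) \<Rightarrow> bool" where
  "represents M E w \<longleftrightarrow> (\<forall>u<n. M (cell b u) = degree E u \<and>
     M (Suc (cell b u)) = \<Sum> (nbrs E u) \<and> M (Suc (Suc (cell b u))) = w u)"

definition equivalent_instance :: "nat set set \<Rightarrow> (nat \<Rightarrow> nat) \<Rightarrow> bool" where
  "equivalent_instance E w \<longleftrightarrow> E \<subseteq> edges F \<and>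
     (has_deletion_set (verts F) E w k \<longleftrightarrow> linear_forest_deletion_yes (F, k))"

text \<open>One scan over the vertices finds all leaves: peeling a leaf can turn only its neighbour into a
  leaf, and this neighbour is examined next.\<close>

definition scanned :: "nat set set \<Rightarrow> nat \<Rightarrow> nat \<Rightarrow> bool" where
  "scanned E i v \<longleftrightarrow> (\<forall>u<n. u \<le> i \<longrightarrow> degree E u = 1 \<longrightarrow> u = v)"

lemma leafI:
  assumes "E \<subseteq> edges F" "nbrs E v = {p}"
  shows "leaf (verts F) E v p"
proof
  have p: "p \<in> nbrs (edges F) v" using nbrs_mono[OF assms(1), of v] assms(2) by simp
  then have "v \<in> nbrs (edges F) p" using mem_nbrs_commute[of p _ v] by simp
  with p show "v \<in> verts F" "p \<in> verts F" "v \<noteq> p"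
    using nbrs_subset_verts[OF simple] self_notin_nbrs[OF simple] by blast+
qed (simp_all add: verts assms(2))

lemma equivalent_instance_peel:
  assumes "equivalent_instance E w" "leaf (verts F) E v p"
  shows "equivalent_instance (E - {{v, p}}) (peel_weight v p w)"
  using assms by (auto simp: equivalent_instance_def leaf.has_deletion_set_peel)

lemma scanned_peel:
  assumes "scanned E i v" "nbrs E v = {p}"
  shows "scanned (E - {{v, p}}) i p"
  unfolding scanned_def
proof (intro allI impI)
  fix u assume u: "u < n" "u \<le> i" "degree (E - {{v, p}}) u = 1"
  then have "u \<noteq> v" using assms(2) by (auto simp: nbrs_remove_edge)
  moreover have "degree E u = 1" if "u \<noteq> p"
    using u(3) nbrs_remove_edge(3)[OF \<open>u \<noteq> v\<close> that, of E] by simp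
  ultimately show "u = p" using assms(1) u(1,2) unfolding scanned_def by blast
qed

lemma represents_peel:
  assumes M: "represents M E w" and E: "E \<subseteq> edges F" "leaf (verts F) E v p"
  shows "represents (peel_memory b v p M) (E - {{v, p}}) (peel_weight v p w)"
  unfolding represents_def
proof (intro allI impI)
  let ?E = "E - {{v, p}}"
  note nbrs_leaf = leaf.nbrs_leaf[OF E(2)]
  note cells = M[unfolded represents_def, rule_format]
  fix u assume u: "u < n"
  have p: "p < n" "v < n" "v \<noteq> p" using leaf.verts[OF E(2)] verts by auto
  have finite: "finite (nbrs E p)"
    using nbrs_mono[OF E(1)] finite_nbrs[OF simple] by (rule finite_subset)
  have v: "v \<in> nbrs E p" using nbrs_leaf mem_nbrs_commute[of v E p] by simp
  consider "u = v" | "u = p" | "u \<noteq> v" "u \<noteq> p" by blast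
  then show "peel_memory b v p M (cell b u) = degree ?E u \<and>
      peel_memory b v p M (Suc (cell b u)) = \<Sum> (nbrs ?E u) \<and>
      peel_memory b v p M (Suc (Suc (cell b u))) = peel_weight v p w u"
  proof cases
    case 1
    then show ?thesis using cells p nbrs_leaf
      by (simp add: peel_memory_def peel_weight_def cell_neq nbrs_remove_edge)
  next
    case 2
    have "degree ?E p = degree E p - 1" "\<Sum> (nbrs ?E p) = \<Sum> (nbrs E p) - v"
      using v finite sum.remove[OF finite v, of id] by (simp_all add: nbrs_remove_edge)
    then show ?thesis using 2 cells p
      by (simp add: peel_memory_def peel_weight_def cell_neq)
  next
    case 3
    then show ?thesis using cells[OF u]
      by (simp add: peel_memory_def peel_weight_def cell_neq nbrs_remove_edge)
  qed
qed

definition peeling :: "nat \<Rightarrow> ram_state \<Rightarrow> bool" where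
  "peeling m = (\<lambda>(R, M). const_regs n k b R \<and> R reg_loop = n - R reg_pos \<and> R reg_pos \<le> n \<and>
     (R reg_leaf < n \<longleftrightarrow> R reg_pos < n) \<and>
     (\<exists>E w. equivalent_instance E w \<and> represents M E w \<and> scanned E (R reg_pos) (R reg_leaf) \<and>
        m = card E + (n - R reg_pos)))"

lemma peeling_step:
  assumes "peeling m s" "fst s reg_loop \<noteq> 0"
  shows "0 < m \<and> peeling (m - 1) (run peel_body s)"
proof -
  obtain R M where s: "s = (R, M)" by (cases s)
  obtain R' M' where run: "run peel_body (R, M) = (R', M')" by fastforce
  define v where "v = R reg_leaf"
  have R: "const_regs n k b R" "R reg_loop = n - R reg_pos" "R reg_pos < n" "v < n"
    using assms by (auto simp: peeling_def s v_def)
  obtain E w where E: "equivalent_instance E w" "represents M E w" "scanned E (R reg_pos) v"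
    and m: "m = card E + (n - R reg_pos)"
    using assms(1) by (auto simp: peeling_def s v_def)
  then have subset: "E \<subseteq> edges F" by (simp add: equivalent_instance_def)
  have v_cell: "M (cell b v) = degree E v" "M (Suc (cell b v)) = \<Sum> (nbrs E v)"
    using E(2) R(4) by (auto simp: represents_def)
  have "peeling (m - 1) (R', M')"
  proof (cases "degree E v = 1")
    case True
    then obtain p where p: "nbrs E v = {p}" by (auto simp: card_1_singleton_iff)
    then have leaf: "leaf (verts F) E v p" using subset by (rule leafI[rotated])
    then have "p < n" "p \<noteq> v" using verts leaf.verts[OF leaf] by auto
    then have R': "const_regs n k b R'" "R' reg_pos = R reg_pos" "R' reg_leaf = p"
      "R' reg_loop = R reg_loop" "M' = peel_memory b v p M"
      using run_peel_body_leaf[OF R(1) v_def[symmetric], of M p] v_cell p True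
      by (simp_all add: run)
    have "{v, p} \<in> E" using p by (auto simp: nbrs_def)
    then have "card E = Suc (card (E - {{v, p}}))"
      using subset finite_edges[OF simple] finite_subset by (metis card_Suc_Diff1)
    then show ?thesis unfolding peeling_def prod.case
      using R R' m \<open>p < n\<close> equivalent_instance_peel[OF E(1) leaf]
        represents_peel[OF E(2) subset leaf] scanned_peel[OF E(3) p]
      by (intro conjI exI[of _ "E - {{v, p}}"] exI[of _ "peel_weight v p w"]) simp_all
  next
    case False
    then have R': "const_regs n k b R'" "R' reg_pos = Suc (R reg_pos)"
      "R' reg_leaf = Suc (R reg_pos)" "R' reg_loop = n - Suc (R reg_pos)" "M' = M"
      using run_peel_body_skip[OF R(1), of M] v_cell by (simp_all add: v_def run)
    have "scanned E (Suc (R reg_pos)) (Suc (R reg_pos))"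
      using E(3) False by (auto simp: scanned_def le_Suc_eq)
    then show ?thesis unfolding peeling_def prod.case
      using R R' m E by (intro conjI exI[of _ E] exI[of _ w]) simp_all
  qed
  then show ?thesis using R(3) m by (simp add: s run)
qed

lemma equivalent_instance_edgeless:
  assumes "equivalent_instance E w" "scanned E n v" "\<not> v < n"
  shows "card {u. u < n \<and> 3 \<le> w u} \<le> k \<longleftrightarrow> linear_forest_deletion_yes (F, k)"
proof -
  let ?G = "\<lparr>verts = verts F, edges = E\<rparr>"
  have subset: "E \<subseteq> edges F" using assms(1) by (simp add: equivalent_instance_def)
  then have "simple_graph ?G" using simple by (auto simp: simple_graph_def)
  then have "forest ?G" using forest_subgraph[OF forest] subset by simp
  moreover have "degree E u \<noteq> 1" if "u < n" for u
    using assms(2,3) that by (auto simp: scanned_def)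
  ultimately have "E = {}" using forest_obtain_leaf[of ?G] verts by auto
  then show ?thesis
    using assms(1) has_deletion_set_edgeless[of "verts F" w k] verts
    by (simp add: equivalent_instance_def)
qed

lemma peel_prog_correct:
  assumes "const_regs n k b R" "represents M (edges F) (\<lambda>_. 0)"
  shows "ends_within (100 * (n + 1)) peel_prog (R, M)
    (\<lambda>(R', M'). const_regs n k b R' \<and>
       (card {u. u < n \<and> 3 \<le> M' (Suc (Suc (cell b u)))} \<le> k \<longleftrightarrow> linear_forest_deletion_yes (F, k)))"
    (is "ends_within _ _ _ ?post")
proof -
  let ?m = "card (edges F) + n"
  have "equivalent_instance (edges F) (\<lambda>_. 0)"
    by (simp add: equivalent_instance_def linear_forest_deletion_yes_iff[OF forest])
  then have "peeling ?m (run peel_init (R, M))"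
    using assms unfolding peeling_def
    by (auto simp: peel_init_def const_regs_def scanned_def
        intro!: exI[of _ "edges F"] exI[of _ "\<lambda>_. 0"])
  then have init: "ends_within (cost peel_init) peel_init (R, M) (peeling ?m)"
    by (intro ends_within_loop_free loop_free_blocks)
  have loop: "ends_within (Suc (cost peel_body) * ?m + 1) (WhileNz reg_loop peel_body) s
      (\<lambda>s'. fst s' reg_loop = 0 \<and> (\<exists>m'. peeling m' s'))" if "peeling ?m s" for s
    by (rule ends_within_WhileNz_loop_free[OF _ that peeling_step]) (simp_all add: loop_free_blocks)
  have "ends_within (cost peel_init + (Suc (cost peel_body) * ?m + 1)) peel_prog (R, M)
      (\<lambda>s'. fst s' reg_loop = 0 \<and> (\<exists>m'. peeling m' s'))"
    unfolding peel_prog_def by (rule ends_within_Seq[OF init loop])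
  then show ?thesis
  proof (rule ends_within_mono)
    have "?m \<le> 2 * n" using forest_card_edges_le[OF forest] verts by simp
    then have "Suc (cost peel_body) * ?m \<le> Suc (cost peel_body) * (2 * n)" by (rule mult_le_mono2)
    then show "cost peel_init + (Suc (cost peel_body) * ?m + 1) \<le> 100 * (n + 1)"
      by (simp add: block_defs)
    fix s assume s: "fst s reg_loop = 0 \<and> (\<exists>m'. peeling m' s)"
    obtain R' M' where RM: "s = (R', M')" by (cases s)
    then have R': "const_regs n k b R'" "R' reg_pos = n" "\<not> R' reg_leaf < n"
      using s by (auto simp: peeling_def)
    obtain E w where E: "equivalent_instance E w" "represents M' E w" "scanned E n (R' reg_leaf)"
      using s R'(2) by (auto simp: peeling_def RM)
    have "{u. u < n \<and> 3 \<le> M' (Suc (Suc (cell b u)))} = {u. u < n \<and> 3 \<le> w u}"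
      using E(2) by (auto simp: represents_def)
    then show "?post s" using R' equivalent_instance_edgeless[OF E(1,3) R'(3)] by (simp add: RM)
  qed
qed

end

lemma count_prog_correct:
  assumes "const_regs n k b R"
  shows "ends_within (100 * (n + 1)) count_prog (R, M)
    (\<lambda>s. fst s 0 = (if card {u. u < n \<and> 3 \<le> M (Suc (Suc (cell b u)))} \<le> k then 1 else 0))"
    (is "ends_within _ _ _ ?post")
proof -
  define heavy where "heavy j = {u. u < j \<and> 3 \<le> M (Suc (Suc (cell b u)))}" for j
  define counting where "counting m = (\<lambda>(R', M'). const_regs n k b R' \<and> M' = M \<and> m \<le> n \<and>
    R' reg_loop = m \<and> R' reg_addr = Suc (Suc (cell b (n - m))) \<and>
    R' reg_pos = card (heavy (n - m)))" for m
  have "counting n (run count_init (R, M))"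
    using assms by (simp add: counting_def count_init_def const_regs_def cell_def heavy_def)
  then have init: "ends_within (cost count_init) count_init (R, M) (counting n)"
    by (intro ends_within_loop_free loop_free_blocks)
  have step: "0 < m \<and> counting (m - 1) (run count_body s)"
    if inv: "counting m s" and nonzero: "fst s reg_loop \<noteq> 0" for m s
  proof -
    obtain R' M' where "s = (R', M')" by (cases s)
    moreover define j where "j = n - m"
    ultimately have s: "s = (R', M)" and m: "0 < m" "n - (m - 1) = Suc j" and
      R': "const_regs n k b R'" "m \<le> n" "R' reg_loop = m" "R' reg_addr = Suc (Suc (cell b j))"
        "R' reg_pos = card (heavy j)"
      using inv nonzero by (auto simp: counting_def)
    have "heavy (Suc j) = (if 3 \<le> M (Suc (Suc (cell b j))) then insert j (heavy j) else heavy j)"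
      by (auto simp: heavy_def less_Suc_eq)
    then have "card (heavy (Suc j)) =
        (if 3 \<le> M (Suc (Suc (cell b j))) then Suc (card (heavy j)) else card (heavy j))"
      by (simp add: heavy_def)
    then show ?thesis unfolding counting_def s m(2)
      using m(1) R' by (auto simp: count_body_def const_regs_def cell_def)
  qed
  have loop: "ends_within (Suc (cost count_body) * n + 1) (WhileNz reg_loop count_body) s
      (\<lambda>s'. fst s' reg_loop = 0 \<and> (\<exists>m. counting m s'))" if "counting n s" for s
    by (rule ends_within_WhileNz_loop_free[OF _ that step]) (simp_all add: loop_free_blocks)
  have answer: "ends_within (cost answer_prog) answer_prog s ?post"
    if "fst s reg_loop = 0 \<and> (\<exists>m. counting m s)" for s
    using that by (intro ends_within_loop_free loop_free_blocks)
      (auto simp: counting_def heavy_def answer_prog_def const_regs_def)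
  have "ends_within (cost count_init + (Suc (cost count_body) * n + 1 + cost answer_prog))
      count_prog (R, M) ?post"
    unfolding count_prog_def by (rule ends_within_Seq[OF init ends_within_Seq[OF loop answer]])
  then show ?thesis by (rule ends_within_mono) (simp_all add: block_defs)
qed

subsection \<open>Correctness\<close>

abbreviation tokens :: "nat list list \<Rightarrow> nat list" where
  "tokens adj \<equiv> concat (map (\<lambda>ns. length ns # ns) adj)"

locale encoded_forest =
  fixes F :: "nat graph" and k :: nat and adj :: "nat list list" and xs :: "nat list"
  assumes forest: "forest F" and verts: "verts F = {..<length adj}"
    and distinct_adj: "\<And>i. i < length adj \<Longrightarrow> distinct (adj ! i)"
    and set_adj: "\<And>i. i < length adj \<Longrightarrow> set (adj ! i) = nbrs (edges F) i"
    and xs: "xs = length adj # k # tokens adj"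
begin

abbreviation n :: nat where "n \<equiv> length adj"

abbreviation b :: nat where "b \<equiv> 3 * n + 3"

sublocale forest_table F n k b
  by unfold_locales (fact forest verts)+

lemma length_adj: "u < n \<Longrightarrow> length (adj ! u) = degree (edges F) u"
  using distinct_card[OF distinct_adj] set_adj by simp

lemma sum_list_adj: "u < n \<Longrightarrow> sum_list (adj ! u) = \<Sum> (nbrs (edges F) u)"
  using sum_list_distinct_conv_sum_set[OF distinct_adj, of u id] set_adj by simp

lemma length_tokens: "length (tokens adj) = n + 2 * card (edges F)"
proof -
  have "length (tokens adj) = (\<Sum>u<n. Suc (length (adj ! u)))"
    by (simp add: length_concat comp_def sum_list_sum_nth atLeast0LessThan)
  also have "\<dots> = n + (\<Sum>u\<in>verts F. degree (edges F) u)"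
    by (simp add: verts length_adj sum_Suc)
  finally show ?thesis by (simp add: sum_degree[OF simple])
qed

lemma length_tokens_le: "length (tokens adj) \<le> 3 * n"
  using forest_card_edges_le[OF forest] by (simp add: length_tokens verts)

definition reading :: "nat \<Rightarrow> ram_state \<Rightarrow> bool" where
  "reading m = (\<lambda>(R, M). const_regs n k b R \<and> (\<exists>j\<le>n. R reg_loop = n - j \<and> R reg_addr = cell b j \<and>
     stored M (R reg_pos) (tokens (drop j adj)) \<and> m = length (tokens (drop j adj)) \<and>
     R reg_pos + m \<le> b \<and>
     (\<forall>u<j. M (cell b u) = length (adj ! u) \<and> M (Suc (cell b u)) = sum_list (adj ! u)) \<and>
     (\<forall>u. M (Suc (Suc (cell b u))) = 0)))"

lemma reading_init: "reading (length (tokens adj)) (run read_init (ram_init xs))"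
proof -
  define M where "M i = (if i < length xs then xs ! i else 0)" for i
  have init: "ram_init xs = (\<lambda>_. 0, M)" by (simp add: ram_init_def M_def[abs_def])
  have "length xs \<le> b" using length_tokens_le by (simp add: xs)
  then have "M (Suc (Suc (cell b u))) = 0" for u by (simp add: M_def cell_def)
  moreover have "stored M 0 xs" by (simp add: stored_iff M_def)
  then have "M 0 = n" "M (Suc 0) = k" "stored M 2 (tokens adj)" by (simp_all add: xs numeral_2_eq_2)
  ultimately show ?thesis unfolding init reading_def
    using length_tokens_le
    by (auto simp: read_init_def const_regs_def cell_def intro!: exI[of _ 0])
qed

lemma reading_step:
  assumes "reading m s" "fst s reg_loop \<noteq> 0"
  shows "\<exists>d. 0 < d \<and> d \<le> m \<and> ends_within (20 * d) read_body s (reading (m - d))"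
proof -
  obtain R M where s: "s = (R, M)" by (cases s)
  obtain j where j: "j < n" "R reg_loop = n - j" "R reg_addr = cell b j"
    and R: "const_regs n k b R" "R reg_pos + m \<le> b"
    and rest: "stored M (R reg_pos) (tokens (drop j adj))" "m = length (tokens (drop j adj))"
    and M: "\<forall>u<j. M (cell b u) = length (adj ! u) \<and> M (Suc (cell b u)) = sum_list (adj ! u)"
      "\<forall>u. M (Suc (Suc (cell b u))) = 0"
    using assms by (auto simp: reading_def s)
  let ?ns = "adj ! j" and ?rest = "tokens (drop (Suc j) adj)"
  have split: "tokens (drop j adj) = length ?ns # ?ns @ ?rest"
    using j(1) by (simp flip: Cons_nth_drop_Suc)
  let ?post = "\<lambda>(R', M'). const_regs n k b R' \<and> R' reg_pos = R reg_pos + Suc (length ?ns) \<and>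
    R' reg_addr = R reg_addr + 3 \<and> R' reg_loop = R reg_loop - 1 \<and>
    M' = M(R reg_addr := length ?ns, Suc (R reg_addr) := sum_list ?ns)"
  have "ends_within (20 * Suc (length ?ns)) read_body (R, M) ?post"
    using rest split R j(3) by (intro read_body_correct) (auto simp: stored_append cell_def)
  then have "ends_within (20 * Suc (length ?ns)) read_body s (reading (m - Suc (length ?ns)))"
    unfolding s
  proof (rule ends_within_mono)
    fix s' :: ram_state
    obtain R' M' where s': "s' = (R', M')" by (cases s')
    assume "?post s'"
    then have R': "const_regs n k b R'" "R' reg_pos = R reg_pos + Suc (length ?ns)"
        "R' reg_addr = cell b (Suc j)" "R' reg_loop = n - Suc j"
      and M': "M' = M(cell b j := length ?ns, Suc (cell b j) := sum_list ?ns)"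
      by (auto simp: s' j cell_def)
    have "stored M' (R' reg_pos) ?rest"
      using rest split R(2) unfolding M' R'(2) by (simp add: stored_append stored_fun_upd cell_def)
    then show "reading (m - Suc (length ?ns)) s'"
      unfolding reading_def s' prod.case using R' R(2) j(1) rest(2) split M
      by (intro conjI exI[of _ "Suc j"]) (auto simp: M' cell_neq less_Suc_eq)
  qed simp
  moreover have "Suc (length ?ns) \<le> m" using rest(2) split by simp
  ultimately show ?thesis by blast
qed

lemma read_prog_correct:
  "ends_within (100 * length xs) read_prog (ram_init xs)
     (\<lambda>(R, M). const_regs n k b R \<and> represents M (edges F) (\<lambda>_. 0))"
proof -
  let ?m = "length (tokens adj)"
  have init: "ends_within (cost read_init) read_init (ram_init xs) (reading ?m)"
    by (intro ends_within_loop_free loop_free_blocks reading_init)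
  have loop: "ends_within (Suc 20 * ?m + 1) (WhileNz reg_loop read_body) s
      (\<lambda>s'. fst s' reg_loop = 0 \<and> (\<exists>m. reading m s'))" if "reading ?m s" for s
    using that reading_step by (rule ends_within_WhileNz)
  have "ends_within (cost read_init + (Suc 20 * ?m + 1)) read_prog (ram_init xs)
      (\<lambda>s'. fst s' reg_loop = 0 \<and> (\<exists>m. reading m s'))"
    unfolding read_prog_def by (rule ends_within_Seq[OF init loop])
  then show ?thesis
    by (rule ends_within_mono)
      (auto simp: xs block_defs reading_def represents_def length_adj sum_list_adj)
qed

lemma linear_forest_deletion_prog_correct:
  "ends_within (400 * (length xs + 1)) linear_forest_deletion_prog (ram_init xs)
     (\<lambda>s. fst s 0 = (if linear_forest_deletion_yes (F, k) then 1 else 0))"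
    (is "ends_within _ _ _ ?answer")
proof -
  have count: "ends_within (100 * (n + 1)) count_prog (R, M) ?answer"
    if "const_regs n k b R"
      "card {u. u < n \<and> 3 \<le> M (Suc (Suc (cell b u)))} \<le> k \<longleftrightarrow> linear_forest_deletion_yes (F, k)"
    for R M
    using count_prog_correct[OF that(1), of M] unfolding that(2) .
  have "ends_within (100 * (n + 1) + 100 * (n + 1)) (Seq peel_prog count_prog) (R, M) ?answer"
    if "const_regs n k b R" "represents M (edges F) (\<lambda>_. 0)" for R M
    by (rule ends_within_Seq[OF peel_prog_correct[OF that]]) (use count in auto)
  then have "ends_within (100 * length xs + (100 * (n + 1) + 100 * (n + 1)))
      linear_forest_deletion_prog (ram_init xs) ?answer"
    unfolding linear_forest_deletion_prog_def
    by (intro ends_within_Seq[OF read_prog_correct]) auto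
  moreover have "n \<le> length xs" using length_tokens by (simp add: xs)
  ultimately show ?thesis by (elim ends_within_mono) simp_all
qed

end

theorem linear_time_decidable_linear_forest_deletion:
  "linear_time_decidable adj_list_encoding
     linear_forest_deletion_instance linear_forest_deletion_yes"
  unfolding linear_time_decidable_def
proof (rule exI[of _ linear_forest_deletion_prog], rule exI[of _ 400], intro allI impI)
  fix x :: "nat graph \<times> nat" and xs
  assume "linear_forest_deletion_instance x" "adj_list_encoding xs x"
  moreover obtain F k where x: "x = (F, k)" by (cases x)
  ultimately obtain adj where "forest F" "verts F = {..<length adj}"
    "\<forall>i<length adj. distinct (adj ! i) \<and> set (adj ! i) = nbrs (edges F) i"
    "xs = length adj # k # tokens adj"
    by (auto simp: linear_forest_deletion_instance_def adj_list_encoding_def nbrs_def)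
  then interpret encoded_forest F k adj xs by unfold_locales auto
  show "\<exists>t R M. ram_exec linear_forest_deletion_prog (ram_init xs) t (R, M) \<and>
     t \<le> 400 * (length xs + 1) \<and> R 0 = (if linear_forest_deletion_yes x then 1 else 0)"
    using linear_forest_deletion_prog_correct unfolding ends_within_def x by auto
qed

theorem theorem3:
  shows "(\<forall>(T :: 'a graph) r v p S.
      rooted_tree T r \<longrightarrow> v \<in> verts T \<longrightarrow> p = parent T r v \<longrightarrow>
      S = claw_deletion_set_proc T r v p \<longrightarrow>
        min_claw_deletion_set (subtree_plus T r v) S \<and>
        (cdn (subtree_plus T r v) = 1 + cdn (subtree T r v) \<longrightarrow> p \<in> Some ` S) \<and>
        (cdn (subtree_plus T r v) = cdn (subtree T r v) \<and>
         cdn (subtree T r v) = 1 + cdn (delete_verts (subtree T r v) {v}) \<longrightarrow> v \<in> S))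
    \<and> linear_time_decidable adj_list_encoding
        linear_forest_deletion_instance linear_forest_deletion_yes"
proof (intro conjI[OF _ linear_time_decidable_linear_forest_deletion] allI impI)
  fix T :: "'a graph" and r v p S
  assume "rooted_tree T r" "v \<in> verts T" and p: "p = parent T r v"
    and S: "S = claw_deletion_set_proc T r v p"
  note correct = claw_deletion_set_proc_correct[OF this(1,2)]
  show "min_claw_deletion_set (subtree_plus T r v) S \<and>
    (cdn (subtree_plus T r v) = 1 + cdn (subtree T r v) \<longrightarrow> p \<in> Some ` S) \<and>
    (cdn (subtree_plus T r v) = cdn (subtree T r v) \<and>
     cdn (subtree T r v) = 1 + cdn (delete_verts (subtree T r v) {v}) \<longrightarrow> v \<in> S)"
    unfolding S p using correct by blast
qed

end
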